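(* Let $\mathcal{L}$ be an essentially finite $h$-signature. Then $\mathrm{HStruc}(\mathcal{L})$ is a closed type, i.e. $\vdash\mathrm{HStruc}(\mathcal{L})\ \mathbf{Type}$ is derivable in HoTT.
   Context: Logical symbols: besides non-logical sort and arrow symbols, there are logical sort symbols $\cong_K$, $\rho_K$, $\tau_f$ and logical arrow symbols $s_K,t_K,r_K,f_1,f_2,e_f$. A FOLDS signature is an inverse category (skeletal, no non-identity endomorphisms, finitely many arrows out of each object) with a proper order (a partial order on objects with $K_f<K$ for each non-identity $f\colon K\to K_f$, and on arrows with $f<g$ when $\operatorname{cod}f<\operatorname{cod}g$); $K/\!/\mathcal{L}$ is the set of non-identity arrows out of $K$, $K_f$ the codomain of $f$; an arrow is top-level if non-identity and not a composite of two non-identity arrows. An $h$-signature is such a FOLDS signature $\mathcal{L}$ with $h\colon\mathrm{Ob}\,\mathcal{L}\to\mathbb{N}\cup\{\infty\}$ ($\infty-m=\infty$) such that: if $\cong_K\in\mathcal{L}$ then $K\in\mathcal{L}$, $h(K)\ge2$, the top-level arrows of $\cong_K$ are exactly $s_K,t_K\colon\cong_K\to K$ (the only arrows $\cong_K\to K$), $gs_K=gt_K$ for every $g$ out of $K$, and $h(\cong_K)=h(K)-1$; if $\rho_K\in\mathcal{L}$ then $h(K)\ge2$, the only top-level arrow of $\rho_K$ is $r_K\colon\rho_K\to\cong_K$, $s_Kr_K=t_Kr_K$, $h(\rho_K)=h(K)-2$; if $\tau_f\in\mathcal{L}$ then $f\colon A\to K$ is top-level for $A$ with $h(K)\ge3$,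 the top-level arrows of $\tau_f$ are $e_f\colon\tau_f\to\cong_K$ and $f_1,f_2\colon\tau_f\to A$, $s_Ke_f=ff_1$, $t_Ke_f=ff_2$, $gf_1=gf_2$ for $g\in A/\!/\mathcal{L}\setminus\{f\}$, $qff_1=qff_2$ for $q\in K/\!/\mathcal{L}$, and $h(\tau_f)=h(A)-1$; and only reflexivity sorts may have $h=0$. $\mathrm{NL}(\mathcal{L})$ is the set of non-logical sorts; essentially finite means $\mathrm{NL}(\mathcal{L})$ finite. HoTT: intensional MLTT with $\Pi,\Sigma,\mathrm{Id},\mathbf{1},\mathbf{0},+$, a univalent universe $\mathcal{U}$ (decoding $\mathrm{El}$) and propositional truncation; $\mathcal{U}^m$ is the type of types in $\mathcal{U}$ of $h$-level $m$ ($\mathcal{U}^\infty=\mathcal{U}$). $\mathrm{HStruc}(\mathcal{L}):=\Sigma(K:T_K)_{K\in\mathrm{NL}(\mathcal{L})}$ (iterated, in order), with $T_K:=\Pi(f:\widehat{K_f})_{f\in K/\!/\mathcal{L}}\ \mathcal{U}^{h(K)}$, type-theoretic variables named by arrows of $\mathcal{L}$ (equal composites name the same variable), where $\widehat{K_f}$ is defined by induction on the level of $K_f$: $\mathrm{El}(\mathrm{app}( *,K_f))$ if $K_f$ has no outgoing non-identity arrows; $\mathrm{El}(\mathrm{app}[K_f(pf)_{p\in K_f/\!/\mathcal{L}}])$ (iterated application of the component $K_f$ to the variables $pf$) if $K_f$ is non-logical; $\mathrm{Id}_{\widehat{K_{sf}}}(sf,tf)$ if $K_f={\cong_A}$ (with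 $s=s_A,t=t_A$); $\mathrm{Id}_{\widehat{K_{rf}}}(rf,\mathrm{refl}_{srf})$ if $K_f=\rho_A$; and $\mathrm{Id}_{\widehat{K_{g_2f}}}\big(g_2f,\ \mathrm{trans}^{\,v.\widehat{K_{g_1f}}[v/gg_1f]}_{e_gf}(g_1f)\big)$ if $K_f=\tau_g$ for a top-level $g\colon A\to K'$, where $v$ is a fresh variable and $\mathrm{trans}$ is transport along a path in a type family.
   Formalization: In the clause for τ_g, the fresh variable v replaces gg₁f only in argument position g of A, not at every occurrence of that variable; with the literal substitution HStruc is ill-typed if another p out of A has pg₁f = gg₁f. *)

theory Defs
  imports Main "HOL-Library.Extended_Nat"
begin

section \<open>FOLDS signatures\<close>

record ('o, 'a) cat =
  Ob :: "'o set"
  Ar :: "'a set"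
  src :: "'a \<Rightarrow> 'o"
  tgt :: "'a \<Rightarrow> 'o"
  ident :: "'o \<Rightarrow> 'a"
  cmp :: "'a \<Rightarrow> 'a \<Rightarrow> 'a"  (infixl "\<bullet>\<index>" 70)

locale category =
  fixes C :: "('o, 'a, 'm) cat_scheme" (structure)
  assumes src_Ob: "f \<in> Ar C \<Longrightarrow> src C f \<in> Ob C"
    and tgt_Ob: "f \<in> Ar C \<Longrightarrow> tgt C f \<in> Ob C"
    and ident_Ar: "K \<in> Ob C \<Longrightarrow> ident C K \<in> Ar C"
    and src_ident: "K \<in> Ob C \<Longrightarrow> src C (ident C K) = K"
    and tgt_ident: "K \<in> Ob C \<Longrightarrow> tgt C (ident C K) = K"
    and cmp_Ar: "\<lbrakk>f \<in> Ar C; g \<in> Ar C; tgt C f = src C g\<rbrakk> \<Longrightarrow> g \<bullet> f \<in> Ar C"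
    and src_cmp: "\<lbrakk>f \<in> Ar C; g \<in> Ar C; tgt C f = src C g\<rbrakk> \<Longrightarrow> src C (g \<bullet> f) = src C f"
    and tgt_cmp: "\<lbrakk>f \<in> Ar C; g \<in> Ar C; tgt C f = src C g\<rbrakk> \<Longrightarrow> tgt C (g \<bullet> f) = tgt C g"
    and ident_right: "f \<in> Ar C \<Longrightarrow> f \<bullet> ident C (src C f) = f"
    and ident_left: "f \<in> Ar C \<Longrightarrow> ident C (tgt C f) \<bullet> f = f"
    and cmp_assoc: "\<lbrakk>f \<in> Ar C; g \<in> Ar C; k \<in> Ar C; tgt C f = src C g; tgt C g = src C k\<rbrakk>
      \<Longrightarrow> (k \<bullet> g) \<bullet> f = k \<bullet> (g \<bullet> f)"

text \<open>\<open>outs C K\<close> is the set \<open>K // C\<close> of non-identity arrows out of \<open>K\<close>.\<close>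

definition outs :: "('o, 'a, 'm) cat_scheme \<Rightarrow> 'o \<Rightarrow> 'a set" where
  "outs C K = {f \<in> Ar C. src C f = K \<and> f \<noteq> ident C K}"

definition top_level :: "('o, 'a, 'm) cat_scheme \<Rightarrow> 'a \<Rightarrow> bool" where
  "top_level C f \<longleftrightarrow> f \<in> outs C (src C f) \<and>
     \<not> (\<exists>g \<in> outs C (src C f). \<exists>k \<in> outs C (tgt C g). f = cmp C k g)"

locale inverse_category = category +
  assumes skeletal: "\<lbrakk>f \<in> Ar C; g \<in> Ar C; src C g = tgt C f; tgt C g = src C f;
      g \<bullet> f = ident C (src C f); f \<bullet> g = ident C (tgt C f)\<rbrakk> \<Longrightarrow> src C f = tgt C f"
    and no_endo: "\<lbrakk>f \<in> Ar C; src C f = tgt C f\<rbrakk> \<Longrightarrow> f = ident C (src C f)"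
    and finite_out: "K \<in> Ob C \<Longrightarrow> finite {f \<in> Ar C. src C f = K}"

definition strict_partial_order_on :: "'x set \<Rightarrow> ('x \<Rightarrow> 'x \<Rightarrow> bool) \<Rightarrow> bool" where
  "strict_partial_order_on S lt \<longleftrightarrow>
     (\<forall>x \<in> S. \<not> lt x x) \<and> (\<forall>x \<in> S. \<forall>y \<in> S. \<forall>z \<in> S. lt x y \<longrightarrow> lt y z \<longrightarrow> lt x z)"

record ('o, 'a) folds_sig = "('o, 'a) cat" +
  ob_less :: "'o \<Rightarrow> 'o \<Rightarrow> bool"
  ar_less :: "'a \<Rightarrow> 'a \<Rightarrow> bool"

locale folds_signature = inverse_category L
  for L :: "('o, 'a, 'm) folds_sig_scheme" (structure) +
  assumes ob_order: "strict_partial_order_on (Ob L) (ob_less L)"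
    and ar_order: "strict_partial_order_on (Ar L) (ar_less L)"
    and ob_less_tgt: "\<lbrakk>K \<in> Ob L; f \<in> outs L K\<rbrakk> \<Longrightarrow> ob_less L (tgt L f) K"
    and ar_less_tgt: "\<lbrakk>f \<in> Ar L; g \<in> Ar L; ob_less L (tgt L f) (tgt L g)\<rbrakk> \<Longrightarrow> ar_less L f g"


section \<open>h-signatures\<close>

text \<open>The label of an object says which sort symbol it is: an object labelled \<open>IsoOf K\<close> is the
  symbol \<open>\<cong>\<^sub>K\<close>, one labelled \<open>ReflOf K\<close> is \<open>\<rho>\<^sub>K\<close>, and one labelled \<open>TransOf f\<close> is \<open>\<tau>\<^sub>f\<close>.  Each of
  these symbols names at most one object.  The logical arrow symbols \<open>s\<^sub>K\<close>, \<open>t\<^sub>K\<close>, \<open>r\<^sub>K\<close>,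
  \<open>f\<^sub>1\<close>, \<open>f\<^sub>2\<close>, \<open>e\<^sub>f\<close> are the functions \<open>sA\<close>, \<open>tA\<close>, \<open>rA\<close>, \<open>arr1\<close>, \<open>arr2\<close>, \<open>eA\<close>, which are
  meaningful only where the corresponding sort is present.\<close>

datatype ('o, 'a) label = NonLogical | IsoOf 'o | ReflOf 'o | TransOf 'a

record ('o, 'a) h_sig = "('o, 'a) folds_sig" +
  label :: "'o \<Rightarrow> ('o, 'a) label"
  sA :: "'o \<Rightarrow> 'a"
  tA :: "'o \<Rightarrow> 'a"
  rA :: "'o \<Rightarrow> 'a"
  arr1 :: "'a \<Rightarrow> 'a"
  arr2 :: "'a \<Rightarrow> 'a"
  eA :: "'a \<Rightarrow> 'a"
  hl :: "'o \<Rightarrow> enat"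

definition top_arrows :: "('o, 'a, 'm) cat_scheme \<Rightarrow> 'o \<Rightarrow> 'a set" where
  "top_arrows C K = {f \<in> Ar C. src C f = K \<and> top_level C f}"

definition NL :: "('o, 'a, 'm) h_sig_scheme \<Rightarrow> 'o set" where
  "NL L = {K \<in> Ob L. label L K = NonLogical}"

definition essentially_finite :: "('o, 'a, 'm) h_sig_scheme \<Rightarrow> bool" where
  "essentially_finite L \<longleftrightarrow> finite (NL L)"

locale h_signature = folds_signature L
  for L :: "('o, 'a, 'm) h_sig_scheme" (structure) +
  assumes label_unique:
      "\<lbrakk>X \<in> Ob L; Y \<in> Ob L; label L X = label L Y; label L X \<noteq> NonLogical\<rbrakk> \<Longrightarrow> X = Y"
    and iso_sort: "\<lbrakk>X \<in> Ob L; label L X = IsoOf K\<rbrakk> \<Longrightarrow>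
        K \<in> Ob L \<and> 2 \<le> hl L K \<and>
        top_arrows L X = {sA L K, tA L K} \<and> sA L K \<noteq> tA L K \<and>
        {f \<in> Ar L. src L f = X \<and> tgt L f = K} = {sA L K, tA L K} \<and>
        (\<forall>g \<in> outs L K. g \<bullet> sA L K = g \<bullet> tA L K) \<and>
        hl L X = hl L K - 1"
    and refl_sort: "\<lbrakk>X \<in> Ob L; label L X = ReflOf K\<rbrakk> \<Longrightarrow>
        2 \<le> hl L K \<and>
        top_arrows L X = {rA L K} \<and>
        label L (tgt L (rA L K)) = IsoOf K \<and>
        sA L K \<bullet> rA L K = tA L K \<bullet> rA L K \<and>
        hl L X = hl L K - 2"
    and trans_sort: "\<lbrakk>X \<in> Ob L; label L X = TransOf f\<rbrakk> \<Longrightarrow>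
        f \<in> Ar L \<and> top_level L f \<and> 3 \<le> hl L (tgt L f) \<and>
        top_arrows L X = {eA L f, arr1 L f, arr2 L f} \<and> distinct [eA L f, arr1 L f, arr2 L f] \<and>
        label L (tgt L (eA L f)) = IsoOf (tgt L f) \<and>
        tgt L (arr1 L f) = src L f \<and> tgt L (arr2 L f) = src L f \<and>
        sA L (tgt L f) \<bullet> eA L f = f \<bullet> arr1 L f \<and>
        tA L (tgt L f) \<bullet> eA L f = f \<bullet> arr2 L f \<and>
        (\<forall>g \<in> outs L (src L f) - {f}. g \<bullet> arr1 L f = g \<bullet> arr2 L f) \<and>
        (\<forall>q \<in> outs L (tgt L f). q \<bullet> f \<bullet> arr1 L f = q \<bullet> f \<bullet> arr2 L f) \<and>
        hl L X = hl L (src L f) - 1"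
    and h_zero: "\<lbrakk>X \<in> Ob L; hl L X = 0\<rbrakk> \<Longrightarrow> \<exists>K. label L X = ReflOf K"


section \<open>Raw syntax of HoTT\<close>

text \<open>De Bruijn indices.  A comment \<open>[n]\<close> marks an argument that binds \<open>n\<close> variables (the last one
  bound has index 0).  \<open>Univ\<close> is the universe (Tarski style, with decoding \<open>El\<close>), \<open>C...\<close> are
  the codes of types in it.\<close>

datatype expr =
    Var nat
  | Pi expr expr                      (* A, B[1] *)
  | Sig expr expr                     (* A, B[1] *)
  | Eq expr expr expr                 (* identity type: A, a, b *)
  | Unit
  | Empty
  | Coprod expr expr
  | Trunc expr
  | Univ
  | El expr
  | Lam expr expr                     (* A, b[1] *)
  | App expr expr
  | Pair expr expr
  | IndSig expr expr expr             (* motive C[1], c[2], p *)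
  | Star
  | IndUnit expr expr expr            (* motive C[1], c, a *)
  | IndEmpty expr expr                (* motive C[1], a *)
  | Inl expr
  | Inr expr
  | IndCoprod expr expr expr expr     (* motive C[1], c[1], d[1], e *)
  | Refl expr
  | IndEq expr expr expr expr expr    (* motive C[3], c[1], a, b, p *)
  | TrIn expr
  | Squash expr expr
  | TrRec expr expr expr expr         (* B, proof that B is a proposition, c[1], a *)
  | CPi expr expr                     (* a, b[1] *)
  | CSig expr expr                    (* a, b[1] *)
  | CEq expr expr expr
  | CUnit
  | CEmpty
  | CCoprod expr expr
  | CTrunc expr
  | Ua expr expr

definition upr :: "(nat \<Rightarrow> nat) \<Rightarrow> nat \<Rightarrow> nat" where
  "upr \<xi> = case_nat 0 (\<lambda>k. Suc (\<xi> k))"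

primrec ren :: "(nat \<Rightarrow> nat) \<Rightarrow> expr \<Rightarrow> expr" where
  "ren \<xi> (Var n) = Var (\<xi> n)"
| "ren \<xi> (Pi A B) = Pi (ren \<xi> A) (ren (upr \<xi>) B)"
| "ren \<xi> (Sig A B) = Sig (ren \<xi> A) (ren (upr \<xi>) B)"
| "ren \<xi> (Eq A a b) = Eq (ren \<xi> A) (ren \<xi> a) (ren \<xi> b)"
| "ren \<xi> Unit = Unit"
| "ren \<xi> Empty = Empty"
| "ren \<xi> (Coprod A B) = Coprod (ren \<xi> A) (ren \<xi> B)"
| "ren \<xi> (Trunc A) = Trunc (ren \<xi> A)"
| "ren \<xi> Univ = Univ"
| "ren \<xi> (El a) = El (ren \<xi> a)"
| "ren \<xi> (Lam A b) = Lam (ren \<xi> A) (ren (upr \<xi>) b)"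
| "ren \<xi> (App f a) = App (ren \<xi> f) (ren \<xi> a)"
| "ren \<xi> (Pair a b) = Pair (ren \<xi> a) (ren \<xi> b)"
| "ren \<xi> (IndSig C c p) = IndSig (ren (upr \<xi>) C) (ren (upr (upr \<xi>)) c) (ren \<xi> p)"
| "ren \<xi> Star = Star"
| "ren \<xi> (IndUnit C c a) = IndUnit (ren (upr \<xi>) C) (ren \<xi> c) (ren \<xi> a)"
| "ren \<xi> (IndEmpty C a) = IndEmpty (ren (upr \<xi>) C) (ren \<xi> a)"
| "ren \<xi> (Inl a) = Inl (ren \<xi> a)"
| "ren \<xi> (Inr a) = Inr (ren \<xi> a)"
| "ren \<xi> (IndCoprod C c d e) =
     IndCoprod (ren (upr \<xi>) C) (ren (upr \<xi>) c) (ren (upr \<xi>) d) (ren \<xi> e)"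
| "ren \<xi> (Refl a) = Refl (ren \<xi> a)"
| "ren \<xi> (IndEq C c a b p) =
     IndEq (ren (upr (upr (upr \<xi>))) C) (ren (upr \<xi>) c) (ren \<xi> a) (ren \<xi> b) (ren \<xi> p)"
| "ren \<xi> (TrIn a) = TrIn (ren \<xi> a)"
| "ren \<xi> (Squash a b) = Squash (ren \<xi> a) (ren \<xi> b)"
| "ren \<xi> (TrRec B q c a) = TrRec (ren \<xi> B) (ren \<xi> q) (ren (upr \<xi>) c) (ren \<xi> a)"
| "ren \<xi> (CPi a b) = CPi (ren \<xi> a) (ren (upr \<xi>) b)"
| "ren \<xi> (CSig a b) = CSig (ren \<xi> a) (ren (upr \<xi>) b)"
| "ren \<xi> (CEq a x y) = CEq (ren \<xi> a) (ren \<xi> x) (ren \<xi> y)"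
| "ren \<xi> CUnit = CUnit"
| "ren \<xi> CEmpty = CEmpty"
| "ren \<xi> (CCoprod a b) = CCoprod (ren \<xi> a) (ren \<xi> b)"
| "ren \<xi> (CTrunc a) = CTrunc (ren \<xi> a)"
| "ren \<xi> (Ua a b) = Ua (ren \<xi> a) (ren \<xi> b)"

abbreviation wk :: "expr \<Rightarrow> expr" where
  "wk \<equiv> ren Suc"

definition ups :: "(nat \<Rightarrow> expr) \<Rightarrow> nat \<Rightarrow> expr" where
  "ups \<sigma> = case_nat (Var 0) (\<lambda>k. wk (\<sigma> k))"

primrec sub :: "(nat \<Rightarrow> expr) \<Rightarrow> expr \<Rightarrow> expr" where
  "sub \<sigma> (Var n) = \<sigma> n"
| "sub \<sigma> (Pi A B) = Pi (sub \<sigma> A) (sub (ups \<sigma>) B)"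
| "sub \<sigma> (Sig A B) = Sig (sub \<sigma> A) (sub (ups \<sigma>) B)"
| "sub \<sigma> (Eq A a b) = Eq (sub \<sigma> A) (sub \<sigma> a) (sub \<sigma> b)"
| "sub \<sigma> Unit = Unit"
| "sub \<sigma> Empty = Empty"
| "sub \<sigma> (Coprod A B) = Coprod (sub \<sigma> A) (sub \<sigma> B)"
| "sub \<sigma> (Trunc A) = Trunc (sub \<sigma> A)"
| "sub \<sigma> Univ = Univ"
| "sub \<sigma> (El a) = El (sub \<sigma> a)"
| "sub \<sigma> (Lam A b) = Lam (sub \<sigma> A) (sub (ups \<sigma>) b)"
| "sub \<sigma> (App f a) = App (sub \<sigma> f) (sub \<sigma> a)"
| "sub \<sigma> (Pair a b) = Pair (sub \<sigma> a) (sub \<sigma> b)"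
| "sub \<sigma> (IndSig C c p) = IndSig (sub (ups \<sigma>) C) (sub (ups (ups \<sigma>)) c) (sub \<sigma> p)"
| "sub \<sigma> Star = Star"
| "sub \<sigma> (IndUnit C c a) = IndUnit (sub (ups \<sigma>) C) (sub \<sigma> c) (sub \<sigma> a)"
| "sub \<sigma> (IndEmpty C a) = IndEmpty (sub (ups \<sigma>) C) (sub \<sigma> a)"
| "sub \<sigma> (Inl a) = Inl (sub \<sigma> a)"
| "sub \<sigma> (Inr a) = Inr (sub \<sigma> a)"
| "sub \<sigma> (IndCoprod C c d e) =
     IndCoprod (sub (ups \<sigma>) C) (sub (ups \<sigma>) c) (sub (ups \<sigma>) d) (sub \<sigma> e)"
| "sub \<sigma> (Refl a) = Refl (sub \<sigma> a)"
| "sub \<sigma> (IndEq C c a b p) =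
     IndEq (sub (ups (ups (ups \<sigma>))) C) (sub (ups \<sigma>) c) (sub \<sigma> a) (sub \<sigma> b) (sub \<sigma> p)"
| "sub \<sigma> (TrIn a) = TrIn (sub \<sigma> a)"
| "sub \<sigma> (Squash a b) = Squash (sub \<sigma> a) (sub \<sigma> b)"
| "sub \<sigma> (TrRec B q c a) = TrRec (sub \<sigma> B) (sub \<sigma> q) (sub (ups \<sigma>) c) (sub \<sigma> a)"
| "sub \<sigma> (CPi a b) = CPi (sub \<sigma> a) (sub (ups \<sigma>) b)"
| "sub \<sigma> (CSig a b) = CSig (sub \<sigma> a) (sub (ups \<sigma>) b)"
| "sub \<sigma> (CEq a x y) = CEq (sub \<sigma> a) (sub \<sigma> x) (sub \<sigma> y)"
| "sub \<sigma> CUnit = CUnit"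
| "sub \<sigma> CEmpty = CEmpty"
| "sub \<sigma> (CCoprod a b) = CCoprod (sub \<sigma> a) (sub \<sigma> b)"
| "sub \<sigma> (CTrunc a) = CTrunc (sub \<sigma> a)"
| "sub \<sigma> (Ua a b) = Ua (sub \<sigma> a) (sub \<sigma> b)"

text \<open>\<open>inst B a\<close> is \<open>B[a/x]\<close> for the last variable \<open>x\<close>.  \<open>shift n\<close> is the inclusion of a
  context into its extension by \<open>n\<close> variables.\<close>

definition scons :: "expr \<Rightarrow> (nat \<Rightarrow> expr) \<Rightarrow> nat \<Rightarrow> expr"  (infixr "\<cdot>" 65) where
  "a \<cdot> \<sigma> = case_nat a \<sigma>"

abbreviation inst :: "expr \<Rightarrow> expr \<Rightarrow> expr" where
  "inst B a \<equiv> sub (a \<cdot> Var) B"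

abbreviation shift :: "nat \<Rightarrow> nat \<Rightarrow> expr" where
  "shift n \<equiv> \<lambda>k. Var (k + n)"

abbreviation arrow :: "expr \<Rightarrow> expr \<Rightarrow> expr" where
  "arrow A B \<equiv> Pi A (wk B)"

abbreviation prod_ty :: "expr \<Rightarrow> expr \<Rightarrow> expr" where
  "prod_ty A B \<equiv> Sig A (wk B)"

definition is_prop :: "expr \<Rightarrow> expr" where
  "is_prop A = Pi A (Pi (wk A) (Eq (wk (wk A)) (Var 1) (Var 0)))"

text \<open>Equivalences are bi-invertible maps.\<close>

definition is_equiv :: "expr \<Rightarrow> expr \<Rightarrow> expr \<Rightarrow> expr" where
  "is_equiv A B f = prod_ty
     (Sig (arrow B A) (Pi (wk A)
        (Eq (wk (wk A)) (App (Var 1) (App (wk (wk f)) (Var 0))) (Var 0))))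
     (Sig (arrow B A) (Pi (wk B)
        (Eq (wk (wk B)) (App (wk (wk f)) (App (Var 1) (Var 0))) (Var 0))))"

definition equiv_ty :: "expr \<Rightarrow> expr \<Rightarrow> expr" where
  "equiv_ty A B = Sig (arrow A B) (is_equiv (wk A) (wk B) (Var 0))"

definition id_equiv :: "expr \<Rightarrow> expr" where
  "id_equiv A = (let i = Lam A (Var 0); r = Lam A (Refl (Var 0)) in
     Pair i (Pair (Pair i r) (Pair i r)))"

definition id_to_equiv :: "expr \<Rightarrow> expr \<Rightarrow> expr" where
  "id_to_equiv a b = Lam (Eq Univ a b)
     (IndEq (equiv_ty (El (Var 2)) (El (Var 1))) (id_equiv (El (Var 0))) (wk a) (wk b) (Var 0))"


section \<open>Derivability\<close>

datatype judgement =
    IsCtx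
  | IsType expr
  | EqType expr expr
  | HasType expr expr              (* a : A *)
  | EqTerm expr expr expr          (* a = b : A *)

primrec ren_j :: "(nat \<Rightarrow> nat) \<Rightarrow> judgement \<Rightarrow> judgement" where
  "ren_j \<xi> IsCtx = IsCtx"
| "ren_j \<xi> (IsType A) = IsType (ren \<xi> A)"
| "ren_j \<xi> (EqType A B) = EqType (ren \<xi> A) (ren \<xi> B)"
| "ren_j \<xi> (HasType a A) = HasType (ren \<xi> a) (ren \<xi> A)"
| "ren_j \<xi> (EqTerm a b A) = EqTerm (ren \<xi> a) (ren \<xi> b) (ren \<xi> A)"

primrec sub_j :: "(nat \<Rightarrow> expr) \<Rightarrow> judgement \<Rightarrow> judgement" where
  "sub_j \<sigma> IsCtx = IsCtx"
| "sub_j \<sigma> (IsType A) = IsType (sub \<sigma> A)"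
| "sub_j \<sigma> (EqType A B) = EqType (sub \<sigma> A) (sub \<sigma> B)"
| "sub_j \<sigma> (HasType a A) = HasType (sub \<sigma> a) (sub \<sigma> A)"
| "sub_j \<sigma> (EqTerm a b A) = EqTerm (sub \<sigma> a) (sub \<sigma> b) (sub \<sigma> A)"

text \<open>Contexts are lists of types whose head is the type of the variable with index 0; the type at
  position \<open>i\<close> lives in the context formed by the later positions.  Weakening and substitution are
  admissible; as rules they do not change what is derivable.\<close>

inductive derivable :: "expr list \<Rightarrow> judgement \<Rightarrow> bool"  (infix "\<turnstile>" 50) where
  \<comment> \<open>structural rules\<close>
  ctx_empty: "[] \<turnstile> IsCtx"
| ctx_ext: "\<Gamma> \<turnstile> IsType A \<Longrightarrow> A # \<Gamma> \<turnstile> IsCtx"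
| var: "\<lbrakk>\<Gamma> \<turnstile> IsCtx; i < length \<Gamma>\<rbrakk> \<Longrightarrow> \<Gamma> \<turnstile> HasType (Var i) (ren (\<lambda>k. k + Suc i) (\<Gamma> ! i))"
| weakening: "\<lbrakk>\<Gamma> \<turnstile> J; \<Gamma> \<turnstile> IsType A\<rbrakk> \<Longrightarrow> A # \<Gamma> \<turnstile> ren_j Suc J"
| substitution: "\<lbrakk>A # \<Gamma> \<turnstile> J; \<Gamma> \<turnstile> HasType a A\<rbrakk> \<Longrightarrow> \<Gamma> \<turnstile> sub_j (a \<cdot> Var) J"
| ty_refl: "\<Gamma> \<turnstile> IsType A \<Longrightarrow> \<Gamma> \<turnstile> EqType A A"
| ty_sym: "\<Gamma> \<turnstile> EqType A B \<Longrightarrow> \<Gamma> \<turnstile> EqType B A"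
| ty_trans: "\<lbrakk>\<Gamma> \<turnstile> EqType A B; \<Gamma> \<turnstile> EqType B C\<rbrakk> \<Longrightarrow> \<Gamma> \<turnstile> EqType A C"
| tm_refl: "\<Gamma> \<turnstile> HasType a A \<Longrightarrow> \<Gamma> \<turnstile> EqTerm a a A"
| tm_sym: "\<Gamma> \<turnstile> EqTerm a b A \<Longrightarrow> \<Gamma> \<turnstile> EqTerm b a A"
| tm_trans: "\<lbrakk>\<Gamma> \<turnstile> EqTerm a b A; \<Gamma> \<turnstile> EqTerm b c A\<rbrakk> \<Longrightarrow> \<Gamma> \<turnstile> EqTerm a c A"
| conv: "\<lbrakk>\<Gamma> \<turnstile> HasType a A; \<Gamma> \<turnstile> EqType A B\<rbrakk> \<Longrightarrow> \<Gamma> \<turnstile> HasType a B"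
| conv_eq: "\<lbrakk>\<Gamma> \<turnstile> EqTerm a b A; \<Gamma> \<turnstile> EqType A B\<rbrakk> \<Longrightarrow> \<Gamma> \<turnstile> EqTerm a b B"
  \<comment> \<open>dependent functions\<close>
| pi_form: "\<lbrakk>\<Gamma> \<turnstile> IsType A; A # \<Gamma> \<turnstile> IsType B\<rbrakk> \<Longrightarrow> \<Gamma> \<turnstile> IsType (Pi A B)"
| pi_cong: "\<lbrakk>\<Gamma> \<turnstile> EqType A A'; A # \<Gamma> \<turnstile> EqType B B'\<rbrakk> \<Longrightarrow> \<Gamma> \<turnstile> EqType (Pi A B) (Pi A' B')"
| lam: "\<lbrakk>\<Gamma> \<turnstile> IsType A; A # \<Gamma> \<turnstile> HasType b B\<rbrakk> \<Longrightarrow> \<Gamma> \<turnstile> HasType (Lam A b) (Pi A B)"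
| lam_cong: "\<lbrakk>\<Gamma> \<turnstile> EqType A A'; A # \<Gamma> \<turnstile> EqTerm b b' B\<rbrakk>
    \<Longrightarrow> \<Gamma> \<turnstile> EqTerm (Lam A b) (Lam A' b') (Pi A B)"
| app: "\<lbrakk>\<Gamma> \<turnstile> HasType f (Pi A B); \<Gamma> \<turnstile> HasType a A\<rbrakk> \<Longrightarrow> \<Gamma> \<turnstile> HasType (App f a) (inst B a)"
| app_cong: "\<lbrakk>\<Gamma> \<turnstile> EqTerm f f' (Pi A B); \<Gamma> \<turnstile> EqTerm a a' A\<rbrakk>
    \<Longrightarrow> \<Gamma> \<turnstile> EqTerm (App f a) (App f' a') (inst B a)"
| pi_beta: "\<lbrakk>A # \<Gamma> \<turnstile> HasType b B; \<Gamma> \<turnstile> HasType a A\<rbrakk>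
    \<Longrightarrow> \<Gamma> \<turnstile> EqTerm (App (Lam A b) a) (inst b a) (inst B a)"
| pi_eta: "\<Gamma> \<turnstile> HasType f (Pi A B) \<Longrightarrow> \<Gamma> \<turnstile> EqTerm f (Lam A (App (wk f) (Var 0))) (Pi A B)"
  \<comment> \<open>dependent pairs\<close>
| sig_form: "\<lbrakk>\<Gamma> \<turnstile> IsType A; A # \<Gamma> \<turnstile> IsType B\<rbrakk> \<Longrightarrow> \<Gamma> \<turnstile> IsType (Sig A B)"
| sig_cong: "\<lbrakk>\<Gamma> \<turnstile> EqType A A'; A # \<Gamma> \<turnstile> EqType B B'\<rbrakk> \<Longrightarrow> \<Gamma> \<turnstile> EqType (Sig A B) (Sig A' B')"
| pair: "\<lbrakk>A # \<Gamma> \<turnstile> IsType B; \<Gamma> \<turnstile> HasType a A; \<Gamma> \<turnstile> HasType b (inst B a)\<rbrakk>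
    \<Longrightarrow> \<Gamma> \<turnstile> HasType (Pair a b) (Sig A B)"
| pair_cong: "\<lbrakk>A # \<Gamma> \<turnstile> IsType B; \<Gamma> \<turnstile> EqTerm a a' A; \<Gamma> \<turnstile> EqTerm b b' (inst B a)\<rbrakk>
    \<Longrightarrow> \<Gamma> \<turnstile> EqTerm (Pair a b) (Pair a' b') (Sig A B)"
| ind_sig: "\<lbrakk>Sig A B # \<Gamma> \<turnstile> IsType C;
     B # A # \<Gamma> \<turnstile> HasType c (sub (Pair (Var 1) (Var 0) \<cdot> shift 2) C);
     \<Gamma> \<turnstile> HasType p (Sig A B)\<rbrakk>
    \<Longrightarrow> \<Gamma> \<turnstile> HasType (IndSig C c p) (inst C p)"
| ind_sig_cong: "\<lbrakk>Sig A B # \<Gamma> \<turnstile> EqType C C';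
     B # A # \<Gamma> \<turnstile> EqTerm c c' (sub (Pair (Var 1) (Var 0) \<cdot> shift 2) C);
     \<Gamma> \<turnstile> EqTerm p p' (Sig A B)\<rbrakk>
    \<Longrightarrow> \<Gamma> \<turnstile> EqTerm (IndSig C c p) (IndSig C' c' p') (inst C p)"
| sig_beta: "\<lbrakk>Sig A B # \<Gamma> \<turnstile> IsType C;
     B # A # \<Gamma> \<turnstile> HasType c (sub (Pair (Var 1) (Var 0) \<cdot> shift 2) C);
     \<Gamma> \<turnstile> HasType a A; \<Gamma> \<turnstile> HasType b (inst B a)\<rbrakk>
    \<Longrightarrow> \<Gamma> \<turnstile> EqTerm (IndSig C c (Pair a b)) (sub (b \<cdot> a \<cdot> Var) c) (inst C (Pair a b))"
  \<comment> \<open>unit type\<close>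
| unit_form: "\<Gamma> \<turnstile> IsCtx \<Longrightarrow> \<Gamma> \<turnstile> IsType Unit"
| star: "\<Gamma> \<turnstile> IsCtx \<Longrightarrow> \<Gamma> \<turnstile> HasType Star Unit"
| ind_unit: "\<lbrakk>Unit # \<Gamma> \<turnstile> IsType C; \<Gamma> \<turnstile> HasType c (inst C Star); \<Gamma> \<turnstile> HasType a Unit\<rbrakk>
    \<Longrightarrow> \<Gamma> \<turnstile> HasType (IndUnit C c a) (inst C a)"
| ind_unit_cong: "\<lbrakk>Unit # \<Gamma> \<turnstile> EqType C C'; \<Gamma> \<turnstile> EqTerm c c' (inst C Star);
     \<Gamma> \<turnstile> EqTerm a a' Unit\<rbrakk>
    \<Longrightarrow> \<Gamma> \<turnstile> EqTerm (IndUnit C c a) (IndUnit C' c' a') (inst C a)"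
| unit_beta: "\<lbrakk>Unit # \<Gamma> \<turnstile> IsType C; \<Gamma> \<turnstile> HasType c (inst C Star)\<rbrakk>
    \<Longrightarrow> \<Gamma> \<turnstile> EqTerm (IndUnit C c Star) c (inst C Star)"
  \<comment> \<open>empty type\<close>
| empty_form: "\<Gamma> \<turnstile> IsCtx \<Longrightarrow> \<Gamma> \<turnstile> IsType Empty"
| ind_empty: "\<lbrakk>Empty # \<Gamma> \<turnstile> IsType C; \<Gamma> \<turnstile> HasType a Empty\<rbrakk>
    \<Longrightarrow> \<Gamma> \<turnstile> HasType (IndEmpty C a) (inst C a)"
| ind_empty_cong: "\<lbrakk>Empty # \<Gamma> \<turnstile> EqType C C'; \<Gamma> \<turnstile> EqTerm a a' Empty\<rbrakk>
    \<Longrightarrow> \<Gamma> \<turnstile> EqTerm (IndEmpty C a) (IndEmpty C' a') (inst C a)"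
  \<comment> \<open>coproducts\<close>
| coprod_form: "\<lbrakk>\<Gamma> \<turnstile> IsType A; \<Gamma> \<turnstile> IsType B\<rbrakk> \<Longrightarrow> \<Gamma> \<turnstile> IsType (Coprod A B)"
| coprod_cong: "\<lbrakk>\<Gamma> \<turnstile> EqType A A'; \<Gamma> \<turnstile> EqType B B'\<rbrakk>
    \<Longrightarrow> \<Gamma> \<turnstile> EqType (Coprod A B) (Coprod A' B')"
| inl: "\<lbrakk>\<Gamma> \<turnstile> IsType B; \<Gamma> \<turnstile> HasType a A\<rbrakk> \<Longrightarrow> \<Gamma> \<turnstile> HasType (Inl a) (Coprod A B)"
| inl_cong: "\<lbrakk>\<Gamma> \<turnstile> IsType B; \<Gamma> \<turnstile> EqTerm a a' A\<rbrakk> \<Longrightarrow> \<Gamma> \<turnstile> EqTerm (Inl a) (Inl a') (Coprod A B)"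
| inr: "\<lbrakk>\<Gamma> \<turnstile> IsType A; \<Gamma> \<turnstile> HasType b B\<rbrakk> \<Longrightarrow> \<Gamma> \<turnstile> HasType (Inr b) (Coprod A B)"
| inr_cong: "\<lbrakk>\<Gamma> \<turnstile> IsType A; \<Gamma> \<turnstile> EqTerm b b' B\<rbrakk> \<Longrightarrow> \<Gamma> \<turnstile> EqTerm (Inr b) (Inr b') (Coprod A B)"
| ind_coprod: "\<lbrakk>Coprod A B # \<Gamma> \<turnstile> IsType C;
     A # \<Gamma> \<turnstile> HasType c (sub (Inl (Var 0) \<cdot> shift 1) C);
     B # \<Gamma> \<turnstile> HasType d (sub (Inr (Var 0) \<cdot> shift 1) C);
     \<Gamma> \<turnstile> HasType e (Coprod A B)\<rbrakk>
    \<Longrightarrow> \<Gamma> \<turnstile> HasType (IndCoprod C c d e) (inst C e)"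
| ind_coprod_cong: "\<lbrakk>Coprod A B # \<Gamma> \<turnstile> EqType C C';
     A # \<Gamma> \<turnstile> EqTerm c c' (sub (Inl (Var 0) \<cdot> shift 1) C);
     B # \<Gamma> \<turnstile> EqTerm d d' (sub (Inr (Var 0) \<cdot> shift 1) C);
     \<Gamma> \<turnstile> EqTerm e e' (Coprod A B)\<rbrakk>
    \<Longrightarrow> \<Gamma> \<turnstile> EqTerm (IndCoprod C c d e) (IndCoprod C' c' d' e') (inst C e)"
| coprod_beta_inl: "\<lbrakk>Coprod A B # \<Gamma> \<turnstile> IsType C;
     A # \<Gamma> \<turnstile> HasType c (sub (Inl (Var 0) \<cdot> shift 1) C);
     B # \<Gamma> \<turnstile> HasType d (sub (Inr (Var 0) \<cdot> shift 1) C);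
     \<Gamma> \<turnstile> HasType a A\<rbrakk>
    \<Longrightarrow> \<Gamma> \<turnstile> EqTerm (IndCoprod C c d (Inl a)) (inst c a) (inst C (Inl a))"
| coprod_beta_inr: "\<lbrakk>Coprod A B # \<Gamma> \<turnstile> IsType C;
     A # \<Gamma> \<turnstile> HasType c (sub (Inl (Var 0) \<cdot> shift 1) C);
     B # \<Gamma> \<turnstile> HasType d (sub (Inr (Var 0) \<cdot> shift 1) C);
     \<Gamma> \<turnstile> HasType b B\<rbrakk>
    \<Longrightarrow> \<Gamma> \<turnstile> EqTerm (IndCoprod C c d (Inr b)) (inst d b) (inst C (Inr b))"
  \<comment> \<open>identity types\<close>
| eq_form: "\<lbrakk>\<Gamma> \<turnstile> IsType A; \<Gamma> \<turnstile> HasType a A; \<Gamma> \<turnstile> HasType b A\<rbrakk> \<Longrightarrow> \<Gamma> \<turnstile> IsType (Eq A a b)"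
| eq_cong: "\<lbrakk>\<Gamma> \<turnstile> EqType A A'; \<Gamma> \<turnstile> EqTerm a a' A; \<Gamma> \<turnstile> EqTerm b b' A\<rbrakk>
    \<Longrightarrow> \<Gamma> \<turnstile> EqType (Eq A a b) (Eq A' a' b')"
| refl: "\<Gamma> \<turnstile> HasType a A \<Longrightarrow> \<Gamma> \<turnstile> HasType (Refl a) (Eq A a a)"
| refl_cong: "\<Gamma> \<turnstile> EqTerm a a' A \<Longrightarrow> \<Gamma> \<turnstile> EqTerm (Refl a) (Refl a') (Eq A a a)"
| ind_eq: "\<lbrakk>Eq (wk (wk A)) (Var 1) (Var 0) # wk A # A # \<Gamma> \<turnstile> IsType C;
     A # \<Gamma> \<turnstile> HasType c (sub (Refl (Var 0) \<cdot> Var 0 \<cdot> Var 0 \<cdot> shift 1) C);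
     \<Gamma> \<turnstile> HasType a A; \<Gamma> \<turnstile> HasType b A; \<Gamma> \<turnstile> HasType p (Eq A a b)\<rbrakk>
    \<Longrightarrow> \<Gamma> \<turnstile> HasType (IndEq C c a b p) (sub (p \<cdot> b \<cdot> a \<cdot> Var) C)"
| ind_eq_cong: "\<lbrakk>Eq (wk (wk A)) (Var 1) (Var 0) # wk A # A # \<Gamma> \<turnstile> EqType C C';
     A # \<Gamma> \<turnstile> EqTerm c c' (sub (Refl (Var 0) \<cdot> Var 0 \<cdot> Var 0 \<cdot> shift 1) C);
     \<Gamma> \<turnstile> EqTerm a a' A; \<Gamma> \<turnstile> EqTerm b b' A; \<Gamma> \<turnstile> EqTerm p p' (Eq A a b)\<rbrakk>
    \<Longrightarrow> \<Gamma> \<turnstile> EqTerm (IndEq C c a b p) (IndEq C' c' a' b' p') (sub (p \<cdot> b \<cdot> a \<cdot> Var) C)"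
| eq_beta: "\<lbrakk>Eq (wk (wk A)) (Var 1) (Var 0) # wk A # A # \<Gamma> \<turnstile> IsType C;
     A # \<Gamma> \<turnstile> HasType c (sub (Refl (Var 0) \<cdot> Var 0 \<cdot> Var 0 \<cdot> shift 1) C);
     \<Gamma> \<turnstile> HasType a A\<rbrakk>
    \<Longrightarrow> \<Gamma> \<turnstile> EqTerm (IndEq C c a a (Refl a)) (inst c a) (sub (Refl a \<cdot> a \<cdot> a \<cdot> Var) C)"
  \<comment> \<open>propositional truncation\<close>
| trunc_form: "\<Gamma> \<turnstile> IsType A \<Longrightarrow> \<Gamma> \<turnstile> IsType (Trunc A)"
| trunc_cong: "\<Gamma> \<turnstile> EqType A A' \<Longrightarrow> \<Gamma> \<turnstile> EqType (Trunc A) (Trunc A')"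
| tr_in: "\<Gamma> \<turnstile> HasType a A \<Longrightarrow> \<Gamma> \<turnstile> HasType (TrIn a) (Trunc A)"
| tr_in_cong: "\<Gamma> \<turnstile> EqTerm a a' A \<Longrightarrow> \<Gamma> \<turnstile> EqTerm (TrIn a) (TrIn a') (Trunc A)"
| squash: "\<lbrakk>\<Gamma> \<turnstile> HasType a (Trunc A); \<Gamma> \<turnstile> HasType b (Trunc A)\<rbrakk>
    \<Longrightarrow> \<Gamma> \<turnstile> HasType (Squash a b) (Eq (Trunc A) a b)"
| squash_cong: "\<lbrakk>\<Gamma> \<turnstile> EqTerm a a' (Trunc A); \<Gamma> \<turnstile> EqTerm b b' (Trunc A)\<rbrakk>
    \<Longrightarrow> \<Gamma> \<turnstile> EqTerm (Squash a b) (Squash a' b') (Eq (Trunc A) a b)"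
| tr_rec: "\<lbrakk>\<Gamma> \<turnstile> IsType B; \<Gamma> \<turnstile> HasType q (is_prop B); A # \<Gamma> \<turnstile> HasType c (wk B);
     \<Gamma> \<turnstile> HasType a (Trunc A)\<rbrakk>
    \<Longrightarrow> \<Gamma> \<turnstile> HasType (TrRec B q c a) B"
| tr_rec_cong: "\<lbrakk>\<Gamma> \<turnstile> EqType B B'; \<Gamma> \<turnstile> EqTerm q q' (is_prop B); A # \<Gamma> \<turnstile> EqTerm c c' (wk B);
     \<Gamma> \<turnstile> EqTerm a a' (Trunc A)\<rbrakk>
    \<Longrightarrow> \<Gamma> \<turnstile> EqTerm (TrRec B q c a) (TrRec B' q' c' a') B"
| trunc_beta: "\<lbrakk>\<Gamma> \<turnstile> IsType B; \<Gamma> \<turnstile> HasType q (is_prop B); A # \<Gamma> \<turnstile> HasType c (wk B);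
     \<Gamma> \<turnstile> HasType a A\<rbrakk>
    \<Longrightarrow> \<Gamma> \<turnstile> EqTerm (TrRec B q c (TrIn a)) (inst c a) B"
  \<comment> \<open>the universe\<close>
| univ_form: "\<Gamma> \<turnstile> IsCtx \<Longrightarrow> \<Gamma> \<turnstile> IsType Univ"
| el_form: "\<Gamma> \<turnstile> HasType a Univ \<Longrightarrow> \<Gamma> \<turnstile> IsType (El a)"
| el_cong: "\<Gamma> \<turnstile> EqTerm a a' Univ \<Longrightarrow> \<Gamma> \<turnstile> EqType (El a) (El a')"
| c_pi: "\<lbrakk>\<Gamma> \<turnstile> HasType a Univ; El a # \<Gamma> \<turnstile> HasType b Univ\<rbrakk> \<Longrightarrow> \<Gamma> \<turnstile> HasType (CPi a b) Univ"
| c_pi_cong: "\<lbrakk>\<Gamma> \<turnstile> EqTerm a a' Univ; El a # \<Gamma> \<turnstile> EqTerm b b' Univ\<rbrakk>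
    \<Longrightarrow> \<Gamma> \<turnstile> EqTerm (CPi a b) (CPi a' b') Univ"
| el_pi: "\<lbrakk>\<Gamma> \<turnstile> HasType a Univ; El a # \<Gamma> \<turnstile> HasType b Univ\<rbrakk>
    \<Longrightarrow> \<Gamma> \<turnstile> EqType (El (CPi a b)) (Pi (El a) (El b))"
| c_sig: "\<lbrakk>\<Gamma> \<turnstile> HasType a Univ; El a # \<Gamma> \<turnstile> HasType b Univ\<rbrakk> \<Longrightarrow> \<Gamma> \<turnstile> HasType (CSig a b) Univ"
| c_sig_cong: "\<lbrakk>\<Gamma> \<turnstile> EqTerm a a' Univ; El a # \<Gamma> \<turnstile> EqTerm b b' Univ\<rbrakk>
    \<Longrightarrow> \<Gamma> \<turnstile> EqTerm (CSig a b) (CSig a' b') Univ"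
| el_sig: "\<lbrakk>\<Gamma> \<turnstile> HasType a Univ; El a # \<Gamma> \<turnstile> HasType b Univ\<rbrakk>
    \<Longrightarrow> \<Gamma> \<turnstile> EqType (El (CSig a b)) (Sig (El a) (El b))"
| c_eq: "\<lbrakk>\<Gamma> \<turnstile> HasType a Univ; \<Gamma> \<turnstile> HasType x (El a); \<Gamma> \<turnstile> HasType y (El a)\<rbrakk>
    \<Longrightarrow> \<Gamma> \<turnstile> HasType (CEq a x y) Univ"
| c_eq_cong: "\<lbrakk>\<Gamma> \<turnstile> EqTerm a a' Univ; \<Gamma> \<turnstile> EqTerm x x' (El a); \<Gamma> \<turnstile> EqTerm y y' (El a)\<rbrakk>
    \<Longrightarrow> \<Gamma> \<turnstile> EqTerm (CEq a x y) (CEq a' x' y') Univ"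
| el_eq: "\<lbrakk>\<Gamma> \<turnstile> HasType a Univ; \<Gamma> \<turnstile> HasType x (El a); \<Gamma> \<turnstile> HasType y (El a)\<rbrakk>
    \<Longrightarrow> \<Gamma> \<turnstile> EqType (El (CEq a x y)) (Eq (El a) x y)"
| c_unit: "\<Gamma> \<turnstile> IsCtx \<Longrightarrow> \<Gamma> \<turnstile> HasType CUnit Univ"
| el_unit: "\<Gamma> \<turnstile> IsCtx \<Longrightarrow> \<Gamma> \<turnstile> EqType (El CUnit) Unit"
| c_empty: "\<Gamma> \<turnstile> IsCtx \<Longrightarrow> \<Gamma> \<turnstile> HasType CEmpty Univ"
| el_empty: "\<Gamma> \<turnstile> IsCtx \<Longrightarrow> \<Gamma> \<turnstile> EqType (El CEmpty) Empty"
| c_coprod: "\<lbrakk>\<Gamma> \<turnstile> HasType a Univ; \<Gamma> \<turnstile> HasType b Univ\<rbrakk> \<Longrightarrow> \<Gamma> \<turnstile> HasType (CCoprod a b) Univ"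
| c_coprod_cong: "\<lbrakk>\<Gamma> \<turnstile> EqTerm a a' Univ; \<Gamma> \<turnstile> EqTerm b b' Univ\<rbrakk>
    \<Longrightarrow> \<Gamma> \<turnstile> EqTerm (CCoprod a b) (CCoprod a' b') Univ"
| el_coprod: "\<lbrakk>\<Gamma> \<turnstile> HasType a Univ; \<Gamma> \<turnstile> HasType b Univ\<rbrakk>
    \<Longrightarrow> \<Gamma> \<turnstile> EqType (El (CCoprod a b)) (Coprod (El a) (El b))"
| c_trunc: "\<Gamma> \<turnstile> HasType a Univ \<Longrightarrow> \<Gamma> \<turnstile> HasType (CTrunc a) Univ"
| c_trunc_cong: "\<Gamma> \<turnstile> EqTerm a a' Univ \<Longrightarrow> \<Gamma> \<turnstile> EqTerm (CTrunc a) (CTrunc a') Univ"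
| el_trunc: "\<Gamma> \<turnstile> HasType a Univ \<Longrightarrow> \<Gamma> \<turnstile> EqType (El (CTrunc a)) (Trunc (El a))"
  \<comment> \<open>univalence\<close>
| ua: "\<lbrakk>\<Gamma> \<turnstile> HasType a Univ; \<Gamma> \<turnstile> HasType b Univ\<rbrakk>
    \<Longrightarrow> \<Gamma> \<turnstile> HasType (Ua a b) (is_equiv (Eq Univ a b) (equiv_ty (El a) (El b)) (id_to_equiv a b))"
| ua_cong: "\<lbrakk>\<Gamma> \<turnstile> EqTerm a a' Univ; \<Gamma> \<turnstile> EqTerm b b' Univ\<rbrakk>
    \<Longrightarrow> \<Gamma> \<turnstile> EqTerm (Ua a b) (Ua a' b')
          (is_equiv (Eq Univ a b) (equiv_ty (El a) (El b)) (id_to_equiv a b))"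


section \<open>Types of given h-level, and transport\<close>

primrec is_hlevel :: "nat \<Rightarrow> expr \<Rightarrow> expr" where
  "is_hlevel 0 A = Sig A (Pi (wk A) (Eq (wk (wk A)) (Var 1) (Var 0)))"
| "is_hlevel (Suc n) A = Pi A (Pi (wk A) (is_hlevel n (Eq (wk (wk A)) (Var 1) (Var 0))))"

definition UnivH :: "enat \<Rightarrow> expr" where
  "UnivH m = (case m of enat n \<Rightarrow> Sig Univ (is_hlevel n (El (Var 0))) | \<infinity> \<Rightarrow> Univ)"

text \<open>An element of \<open>UnivH m\<close> with finite \<open>m\<close> is a pair, which is decoded through its first
  projection.\<close>

definition proj_univ :: "expr \<Rightarrow> expr" where
  "proj_univ p = IndSig Univ (Var 1) p"

definition ElH :: "enat \<Rightarrow> expr \<Rightarrow> expr" where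
  "ElH m p = (case m of enat n \<Rightarrow> El (proj_univ p) | \<infinity> \<Rightarrow> El p)"

text \<open>\<open>transport B x y e b\<close> is \<open>trans\<^bsup>v.B\<^esup>\<^sub>e(b)\<close> for \<open>e : x = y\<close>, where \<open>v\<close> is index 0 in \<open>B\<close>: path
  induction on \<open>e\<close> into \<open>B[x/v] \<rightarrow> B[y/v]\<close>.  In the motive, \<open>x\<close>, \<open>y\<close> and the path have indices
  2, 1 and 0.\<close>

definition transport :: "expr \<Rightarrow> expr \<Rightarrow> expr \<Rightarrow> expr \<Rightarrow> expr \<Rightarrow> expr" where
  "transport B x y e b = App
     (IndEq (arrow (ren (\<lambda>k. if k = 0 then 2 else k + 2) B) (ren (\<lambda>k. if k = 0 then 1 else k + 2) B))
        (Lam B (Var 0)) x y e) b"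


section \<open>The type of structures of an h-signature\<close>

lemma (in inverse_category) no_return:
  assumes "K \<in> Ob C" "f \<in> outs C K" "g \<in> Ar C" "src C g = tgt C f"
  shows "tgt C g \<noteq> K"
proof
  assume t: "tgt C g = K"
  have f: "f \<in> Ar C" "src C f = K" "f \<noteq> ident C K" using assms(2) by (auto simp: outs_def)
  have "g \<bullet> f = ident C (src C (g \<bullet> f))"
    using f t assms by (intro no_endo) (auto simp: cmp_Ar src_cmp tgt_cmp)
  moreover have "f \<bullet> g = ident C (src C (f \<bullet> g))"
    using f t assms by (intro no_endo) (auto simp: cmp_Ar src_cmp tgt_cmp)
  ultimately have "src C f = tgt C f"
    using f t assms by (intro skeletal[of f g]) (auto simp: src_cmp)
  then show False using no_endo[OF f(1)] f by simp
qed

lemma (in inverse_category) card_out_less: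
  assumes "K \<in> Ob C" "f \<in> outs C K"
  shows "card (tgt C ` {g \<in> Ar C. src C g = tgt C f}) < card (tgt C ` {g \<in> Ar C. src C g = K})"
proof (rule psubset_card_mono)
  show "finite (tgt C ` {g \<in> Ar C. src C g = K})" using finite_out[OF assms(1)] by simp
  have f: "f \<in> Ar C" "src C f = K" using assms(2) by (auto simp: outs_def)
  have "tgt C ` {g \<in> Ar C. src C g = tgt C f} \<subseteq> tgt C ` {g \<in> Ar C. src C g = K}"
  proof
    fix x assume "x \<in> tgt C ` {g \<in> Ar C. src C g = tgt C f}"
    then obtain g where "g \<in> Ar C" "src C g = tgt C f" "x = tgt C g" by auto
    then have "g \<bullet> f \<in> Ar C" "src C (g \<bullet> f) = K" "x = tgt C (g \<bullet> f)"
      using f by (auto simp: cmp_Ar src_cmp tgt_cmp)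
    then show "x \<in> tgt C ` {g \<in> Ar C. src C g = K}" by blast
  qed
  moreover have "K \<in> tgt C ` {g \<in> Ar C. src C g = K}"
    using ident_Ar[OF assms(1)] src_ident[OF assms(1)] tgt_ident[OF assms(1)] by force
  moreover have "K \<notin> tgt C ` {g \<in> Ar C. src C g = tgt C f}"
    using no_return[OF assms] by auto
  ultimately show "tgt C ` {g \<in> Ar C. src C g = tgt C f} \<subset> tgt C ` {g \<in> Ar C. src C g = K}" by blast
qed

text \<open>The orders of a signature are partial; an iterated \<open>\<Pi>\<close> or \<open>\<Sigma>\<close> ``in order'' is taken along
  an enumeration that extends the order.\<close>

definition linear_extension :: "('x \<Rightarrow> 'x \<Rightarrow> bool) \<Rightarrow> 'x set \<Rightarrow> 'x list \<Rightarrow> bool" where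
  "linear_extension lt S xs \<longleftrightarrow>
     distinct xs \<and> set xs = S \<and> sorted_wrt (\<lambda>x y. \<not> lt y x) xs"

lemma linear_extension_exists:
  assumes "finite S" "strict_partial_order_on S lt"
  shows "\<exists>xs. linear_extension lt S xs"
  using assms
proof (induction S rule: finite_remove_induct)
  case empty
  then show ?case by (intro exI[of _ "[]"]) (simp add: linear_extension_def)
next
  case (remove S)
  define R where "R = {(x, y). x \<in> S \<and> y \<in> S \<and> lt x y}"
  have ord: "\<And>x. x \<in> S \<Longrightarrow> \<not> lt x x"
      "\<And>x y z. \<lbrakk>x \<in> S; y \<in> S; z \<in> S; lt x y; lt y z\<rbrakk> \<Longrightarrow> lt x z"
    using remove.prems unfolding strict_partial_order_on_def by metis+
  have "trans R" by (rule transI) (auto simp: R_def intro: ord(2))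
  then have "acyclic R" using ord(1) by (auto simp: acyclic_def R_def)
  moreover have "finite R"
    using remove.hyps(1) by (intro finite_subset[of R "S \<times> S"]) (auto simp: R_def)
  ultimately have "wf R" by (rule finite_acyclic_wf[rotated])
  moreover obtain x where "x \<in> S" using remove.hyps(2) by auto
  ultimately obtain m where m: "m \<in> S" "\<And>y. (y, m) \<in> R \<Longrightarrow> y \<notin> S"
    using wfE_min[of R x S] by metis
  have "strict_partial_order_on (S - {m}) lt"
    using remove.prems unfolding strict_partial_order_on_def by blast
  from remove.IH[OF m(1) this] obtain xs where xs: "linear_extension lt (S - {m}) xs" ..
  have "linear_extension lt S (m # xs)"
    unfolding linear_extension_def
  proof (intro conjI)
    have "\<not> lt y m" if "y \<in> S" for y using m(2)[of y] m(1) that by (auto simp: R_def)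
    then show "sorted_wrt (\<lambda>x y. \<not> lt y x) (m # xs)" using xs by (simp add: linear_extension_def)
  qed (use xs m(1) in \<open>auto simp: linear_extension_def\<close>)
  then show ?case by blast
qed

text \<open>Named variables become environments: \<open>\<eta> K\<close> is the de Bruijn variable bound for the component
  \<open>K\<close>, and \<open>\<sigma> p\<close> the one bound for the arrow \<open>p\<close>.  \<open>hat en \<eta> \<sigma> X\<close> is the type belonging to the
  sort \<open>X\<close> when the variable of each arrow \<open>p\<close> out of \<open>X\<close> is \<open>\<sigma> p\<close>; so for
  \<open>f : K \<rightarrow> K\<^sub>f\<close> the type assigned to the variable \<open>f\<close> is \<open>hat en \<eta> (\<lambda>p. \<sigma> (p \<bullet> f)) K\<^sub>f\<close>.
  \<open>en K\<close> is the enumeration of the arrows out of \<open>K\<close>.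

  In the clause for \<open>\<tau>\<^sub>g\<close> the fresh variable \<open>v\<close> is a new index 0, whence the weakenings.  It
  replaces the argument in position \<open>g\<close> of the sort \<open>A\<close>, and only that one: should
  another arrow \<open>p\<close> out of \<open>A\<close> happen to satisfy \<open>p g\<^sub>1 f = g g\<^sub>1 f\<close>, its variable is left
  alone, as it must be for the identity type to be well-formed.\<close>

context h_signature
begin

definition apply_sort :: "('o \<Rightarrow> 'a list) \<Rightarrow> ('o \<Rightarrow> expr) \<Rightarrow> ('a \<Rightarrow> expr) \<Rightarrow> 'o \<Rightarrow> expr" where
  "apply_sort en \<eta> \<sigma> K =
     (if en K = [] then App (\<eta> K) Star else foldl (\<lambda>u p. App u (\<sigma> p)) (\<eta> K) (en K))"

lemma iso_out:
  assumes "X \<in> Ob L" "label L X = IsoOf K"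
  shows "sA L K \<in> outs L X \<and> tgt L (sA L K) = K"
proof -
  have "sA L K \<in> top_arrows L X" "sA L K \<in> {f \<in> Ar L. src L f = X \<and> tgt L f = K}"
    using iso_sort[OF assms] by auto
  then show ?thesis by (auto simp: top_arrows_def top_level_def)
qed

lemma refl_out:
  assumes "X \<in> Ob L" "label L X = ReflOf K"
  shows "rA L K \<in> outs L X"
  using refl_sort[OF assms] by (auto simp: top_arrows_def top_level_def set_eq_iff)

lemma trans_out:
  assumes "X \<in> Ob L" "label L X = TransOf g"
  shows "arr1 L g \<in> outs L X \<and> tgt L (arr1 L g) = src L g"
  using trans_sort[OF assms] by (auto simp: top_arrows_def top_level_def set_eq_iff)

text \<open>Objects outside the signature get a dummy value.\<close>

function hat :: "('o \<Rightarrow> 'a list) \<Rightarrow> ('o \<Rightarrow> expr) \<Rightarrow> ('a \<Rightarrow> expr) \<Rightarrow> 'o \<Rightarrow> expr" where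
  "hat en \<eta> \<sigma> X = (if X \<notin> Ob L then Empty else
     case label L X of
       NonLogical \<Rightarrow> ElH (hl L X) (apply_sort en \<eta> \<sigma> X)
     | IsoOf A \<Rightarrow>
         Eq (hat en \<eta> (\<lambda>p. \<sigma> (p \<bullet> sA L A)) A) (\<sigma> (sA L A)) (\<sigma> (tA L A))
     | ReflOf A \<Rightarrow>
         Eq (hat en \<eta> (\<lambda>p. \<sigma> (p \<bullet> rA L A)) (tgt L (rA L A)))
            (\<sigma> (rA L A)) (Refl (\<sigma> (sA L A \<bullet> rA L A)))
     | TransOf g \<Rightarrow>
         Eq (hat en \<eta> (\<lambda>p. \<sigma> (p \<bullet> arr2 L g)) (src L g))
            (\<sigma> (arr2 L g))
            (transport
               (hat en (\<lambda>K. wk (\<eta> K)) ((\<lambda>p. wk (\<sigma> (p \<bullet> arr1 L g)))(g := Var 0)) (src L g))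
               (\<sigma> (g \<bullet> arr1 L g)) (\<sigma> (g \<bullet> arr2 L g)) (\<sigma> (eA L g)) (\<sigma> (arr1 L g))))"
  by pat_completeness auto
termination
proof (relation "measure (\<lambda>(en, \<eta>, \<sigma>, X). card (tgt L ` {g \<in> Ar L. src L g = X}))", goal_cases)
  case 1
  then show ?case by simp
next
  case (2 en \<eta> \<sigma> X A)
  then show ?case using iso_out[of X A] card_out_less[of X "sA L A"] by auto
next
  case (3 en \<eta> \<sigma> X A)
  then show ?case using refl_out[of X A] card_out_less[of X "rA L A"] by auto
next
  case (4 en \<eta> \<sigma> X g)
  then show ?case using trans_out[of X g] card_out_less[of X "arr1 L g"] by auto
next
  case (5 en \<eta> \<sigma> X g)
  then show ?case using trans_out[of X g] card_out_less[of X "arr1 L g"] by auto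
qed

declare hat.simps [simp del]

text \<open>Iterated \<open>\<Pi>\<close> over a list of arrows; the codomain \<open>B\<close> is closed, so it needs no weakening.\<close>

primrec pis :: "('o \<Rightarrow> 'a list) \<Rightarrow> ('o \<Rightarrow> expr) \<Rightarrow> ('a \<Rightarrow> expr) \<Rightarrow> expr \<Rightarrow> 'a list \<Rightarrow> expr" where
  "pis en \<eta> \<sigma> B [] = B"
| "pis en \<eta> \<sigma> B (f # fs) =
     Pi (hat en \<eta> (\<lambda>p. \<sigma> (p \<bullet> f)) (tgt L f))
        (pis en (\<lambda>K. wk (\<eta> K)) ((\<lambda>p. wk (\<sigma> p))(f := Var 0)) B fs)"

text \<open>The type \<open>T\<^sub>K\<close> of the component \<open>K\<close>.  The \<open>\<Pi>\<close> over no arrows is \<open>1 \<rightarrow> U\<^sup>h\<^sup>(\<^sup>K\<^sup>)\<close>, which is what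
  the application to \<open>*\<close> in \<open>apply_sort\<close> presupposes.  The initial environment for arrows is a
  dummy: it is overwritten before it is consulted.\<close>

definition sort_type :: "('o \<Rightarrow> 'a list) \<Rightarrow> ('o \<Rightarrow> expr) \<Rightarrow> 'o \<Rightarrow> expr" where
  "sort_type en \<eta> K =
     (if en K = [] then arrow Unit (UnivH (hl L K))
      else pis en \<eta> (\<lambda>_. Star) (UnivH (hl L K)) (en K))"

fun sigs :: "('o \<Rightarrow> 'a list) \<Rightarrow> ('o \<Rightarrow> expr) \<Rightarrow> 'o list \<Rightarrow> expr" where
  "sigs en \<eta> [] = Unit"
| "sigs en \<eta> [K] = sort_type en \<eta> K"
| "sigs en \<eta> (K # Ks) = Sig (sort_type en \<eta> K) (sigs en ((\<lambda>K'. wk (\<eta> K'))(K := Var 0)) Ks)"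

text \<open>\<open>HStruc en Ks\<close> is formed along an enumeration \<open>Ks\<close> of the non-logical sorts and
  enumerations \<open>en K\<close> of the arrows out of each of them; the initial environment is again a
  dummy.\<close>

definition HStruc :: "('o \<Rightarrow> 'a list) \<Rightarrow> 'o list \<Rightarrow> expr" where
  "HStruc en Ks = sigs en (\<lambda>_. Star) Ks"

end

end

theory Submission
  imports Defs
begin

text \<open>Call an assignment of terms to the arrows out of a sort \<open>X\<close> valid if the term of each arrow
  \<open>f\<close> has the type \<open>hat\<close> prescribes for the codomain of \<open>f\<close>.  Validity passes to the codomains
  of arrows by precomposition, so an induction along the inverse category shows that \<open>hat\<close> is a type
  under every valid assignment.  The equations of an h-signature are exactly what makes the
  identity types of the logical sorts well-formed.  For \<open>\<tau>\<^sub>g\<close> the fresh variable may replace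
  the one named \<open>g\<close> because \<open>g\<close> is top-level: no other argument of the sort has a type mentioning
  it.  Arrows and sorts are introduced in an order extending the given one, hence after
  everything that their types depend on.\<close>

section \<open>Renaming and substitution\<close>

lemma ups_Var_comp: "ups (\<lambda>k. Var (\<xi> k)) = (\<lambda>k. Var (upr \<xi> k))"
  by (auto simp: ups_def upr_def split: nat.split)

text \<open>Lets every commutation result proved for \<open>sub\<close> be reused for
  \<open>wk\<close>.\<close>

lemma ren_eq_sub: "ren \<xi> t = sub (\<lambda>k. Var (\<xi> k)) t"
  by (induction t arbitrary: \<xi>) (simp_all add: ups_Var_comp)

lemma ups_upr: "(\<lambda>k. ups \<sigma> (upr \<xi> k)) = ups (\<lambda>k. \<sigma> (\<xi> k))"
  by (auto simp: ups_def upr_def split: nat.split)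

lemma sub_ren: "sub \<sigma> (ren \<xi> t) = sub (\<lambda>k. \<sigma> (\<xi> k)) t"
  by (induction t arbitrary: \<sigma> \<xi>) (simp_all add: ups_upr)

lemma ren_ren: "ren \<xi> (ren \<zeta> t) = ren (\<lambda>k. \<xi> (\<zeta> k)) t"
  by (simp add: ren_eq_sub[of \<xi>] ren_eq_sub[of "\<lambda>k. \<xi> (\<zeta> k)"] sub_ren)

lemma upr_ups: "(\<lambda>k. ren (upr \<xi>) (ups \<sigma> k)) = ups (\<lambda>k. ren \<xi> (\<sigma> k))"
  by (auto simp: ups_def upr_def ren_ren split: nat.split)

lemma ren_sub: "ren \<xi> (sub \<sigma> t) = sub (\<lambda>k. ren \<xi> (\<sigma> k)) t"
  by (induction t arbitrary: \<sigma> \<xi>) (simp_all add: upr_ups)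

lemma ups_Var: "ups Var = Var"
  by (auto simp: ups_def split: nat.split)

lemma sub_Var [simp]: "sub Var t = t"
  by (induction t) (simp_all add: ups_Var)

lemma scons_simps [simp]: "(a \<cdot> \<sigma>) 0 = a" "(a \<cdot> \<sigma>) (Suc k) = \<sigma> k"
  by (simp_all add: scons_def)

lemma scons_shift: "Var 0 \<cdot> (\<lambda>k. Var (Suc k)) = Var"
  by (auto simp: scons_def split: nat.split)

lemma inst_wk [simp]: "inst (wk t) a = t"
  by (simp add: sub_ren)

lemma sub_ups_wk: "sub (ups \<tau>) (wk t) = wk (sub \<tau> t)"
  by (simp add: sub_ren ren_sub ups_def)

section \<open>Substitution through the building blocks of the sort types\<close>

lemma foldl_App_cong:
  "(\<And>p. p \<in> set ps \<Longrightarrow> \<sigma> p = \<sigma>' p) \<Longrightarrow>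
    foldl (\<lambda>u p. App u (\<sigma> p)) v ps = foldl (\<lambda>u p. App u (\<sigma>' p)) v ps"
  by (induction ps arbitrary: v) auto

lemma sub_foldl_App:
  "sub \<tau> (foldl (\<lambda>u p. App u (\<sigma> p)) v ps) = foldl (\<lambda>u p. App u (sub \<tau> (\<sigma> p))) (sub \<tau> v) ps"
  by (induction ps arbitrary: v) auto

text \<open>Environments below a binder weaken every entry and give index 0 to one arrow. Lifted
  substitutions keep this shape, which carries the inductions in \<open>sub_hat\<close> and
  \<open>sub_pis\<close>.\<close>

lemma ups_fun_upd: "(\<lambda>p. sub (ups \<tau>) (((\<lambda>p. wk (\<sigma> p))(g := Var 0)) p)) =
    (\<lambda>p. wk (sub \<tau> (\<sigma> p)))(g := Var 0)"
  by (auto simp: fun_eq_iff sub_ups_wk) (simp add: ups_def)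

lemma sub_is_hlevel: "sub \<tau> (is_hlevel n A) = is_hlevel n (sub \<tau> A)"
  by (induction n arbitrary: A \<tau>) (simp_all add: sub_ups_wk, simp_all add: ups_def)

lemma sub_UnivH [simp]: "sub \<tau> (UnivH m) = UnivH m"
  by (simp add: UnivH_def sub_is_hlevel ups_def split: enat.split)

lemma wk_UnivH [simp]: "wk (UnivH m) = UnivH m"
  by (simp add: ren_eq_sub)

lemma sub_ElH: "sub \<tau> (ElH m p) = ElH m (sub \<tau> p)"
  by (simp add: ElH_def proj_univ_def ups_def split: enat.split)

lemma sub_transport:
  "sub \<tau> (transport B x y e b) =
     transport (sub (ups \<tau>) B) (sub \<tau> x) (sub \<tau> y) (sub \<tau> e) (sub \<tau> b)"
proof -
  \<comment> \<open>The motive binds three variables, so an index \<open>k > 0\<close> of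
    \<open>B\<close>, which already counts \<open>v\<close>, moves by 2; \<open>v\<close> itself
    becomes an endpoint, index 2 or 1.\<close>
  have 1: "sub (ups (ups (ups \<tau>))) (ren (\<lambda>k. if k = 0 then i else k + 2) B) =
      ren (\<lambda>k. if k = 0 then i else k + 2) (sub (ups \<tau>) B)" if "i = 1 \<or> i = 2" for i
    unfolding sub_ren ren_sub
    using that
    by (intro arg_cong[where f = "\<lambda>s. sub s B"])
      (auto simp: fun_eq_iff ups_def ren_ren eval_nat_numeral split: nat.split)
  show ?thesis
    using 1[of 1] 1[of 2] by (simp add: transport_def sub_ups_wk) (simp add: ups_def)
qed


section \<open>Formation rules for h-levels and transport\<close>

lemma weaken_type: "\<lbrakk>\<Gamma> \<turnstile> IsType B; \<Gamma> \<turnstile> IsType A\<rbrakk> \<Longrightarrow> A # \<Gamma> \<turnstile> IsType (wk B)"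
  using weakening[of \<Gamma> "IsType B" A] by simp

lemma weaken_term: "\<lbrakk>\<Gamma> \<turnstile> HasType b B; \<Gamma> \<turnstile> IsType A\<rbrakk> \<Longrightarrow> A # \<Gamma> \<turnstile> HasType (wk b) (wk B)"
  using weakening[of \<Gamma> "HasType b B" A] by simp

lemma var_0: "\<Gamma> \<turnstile> IsType A \<Longrightarrow> A # \<Gamma> \<turnstile> HasType (Var 0) (wk A)"
  using var[OF ctx_ext, of \<Gamma> A 0] by (simp add: ren_eq_sub)

lemma path_form:
  assumes "\<Gamma> \<turnstile> IsType A"
  shows "wk A # A # \<Gamma> \<turnstile> IsType (Eq (wk (wk A)) (Var 1) (Var 0))"
proof -
  have w: "A # \<Gamma> \<turnstile> IsType (wk A)" using assms by (intro weaken_type)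
  have "wk A # A # \<Gamma> \<turnstile> HasType (Var 1) (wk (wk A))"
    using weaken_term[OF var_0[OF assms] w] by simp
  then show ?thesis using assms w by (intro eq_form weaken_type var_0)
qed

lemma is_hlevel_form: "\<Gamma> \<turnstile> IsType A \<Longrightarrow> \<Gamma> \<turnstile> IsType (is_hlevel n A)"
  by (induction n arbitrary: A \<Gamma>) (auto simp del: One_nat_def intro!: sig_form pi_form path_form weaken_type)

lemma UnivH_form: "\<Gamma> \<turnstile> IsCtx \<Longrightarrow> \<Gamma> \<turnstile> IsType (UnivH m)"
proof (cases m)
  case (enat n)
  assume ctx: "\<Gamma> \<turnstile> IsCtx"
  have "Univ # \<Gamma> \<turnstile> HasType (Var 0) Univ"
    using var_0[OF univ_form[OF ctx]] by simp
  then show ?thesis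
    using ctx by (auto simp: UnivH_def enat intro!: sig_form univ_form is_hlevel_form el_form)
qed (auto simp: UnivH_def intro: univ_form)

lemma ElH_form:
  assumes "\<Gamma> \<turnstile> IsCtx" "\<Gamma> \<turnstile> HasType p (UnivH m)"
  shows "\<Gamma> \<turnstile> IsType (ElH m p)"
proof (cases m)
  case (enat n)
  let ?B = "is_hlevel n (El (Var 0))"
  have p: "\<Gamma> \<turnstile> HasType p (Sig Univ ?B)" using assms(2) by (simp add: UnivH_def enat)
  have v: "Univ # \<Gamma> \<turnstile> HasType (Var 0) Univ"
    using var_0[OF univ_form[OF assms(1)]] by simp
  have B: "Univ # \<Gamma> \<turnstile> IsType ?B" using v by (intro is_hlevel_form el_form)
  have S: "\<Gamma> \<turnstile> IsType (Sig Univ ?B)" using assms(1) B by (intro sig_form univ_form)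
  have "?B # Univ # \<Gamma> \<turnstile> HasType (Var 1) Univ"
    using weaken_term[OF v B] by simp
  then have "\<Gamma> \<turnstile> HasType (IndSig Univ (Var 1) p) (inst Univ p)"
    by (intro ind_sig[OF _ _ p] univ_form ctx_ext[OF S]) simp
  then show ?thesis by (simp add: ElH_def enat proj_univ_def el_form)
next
  case infinity
  then show ?thesis using assms(2) by (simp add: ElH_def UnivH_def el_form)
qed

text \<open>Weakening under a binder is not a primitive rule; the third premise spares proving it
  admissible.\<close>

lemma transport_type:
  assumes T: "\<Gamma> \<turnstile> IsType T"
    and B: "T # \<Gamma> \<turnstile> IsType B"
    and B': "wk T # T # \<Gamma> \<turnstile> IsType (ren (upr Suc) B)"
    and x: "\<Gamma> \<turnstile> HasType x T" and y: "\<Gamma> \<turnstile> HasType y T" and e: "\<Gamma> \<turnstile> HasType e (Eq T x y)"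
    and b: "\<Gamma> \<turnstile> HasType b (inst B x)"
  shows "\<Gamma> \<turnstile> HasType (transport B x y e b) (inst B y)"
proof -
  define B1 where "B1 = ren (\<lambda>k. if k = 0 then 2 else k + 2) B"
  define B2 where "B2 = ren (\<lambda>k. if k = 0 then 1 else k + 2) B"
  \<comment> \<open>Both copies of \<open>B\<close> arise by weakening: \<open>v\<close> becomes the
    first endpoint by weakening twice, and the second by weakening below \<open>v\<close> and then
    past the path.\<close>
  have B1: "B1 = wk (wk B)"
    unfolding B1_def ren_ren by (rule arg_cong[where f = "\<lambda>s. ren s B"]) auto
  have B2: "B2 = wk (ren (upr Suc) B)"
    unfolding B2_def ren_ren
    by (rule arg_cong[where f = "\<lambda>s. ren s B"]) (auto simp: upr_def fun_eq_iff split: nat.split)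
  let ?P = "Eq (wk (wk T)) (Var 1) (Var 0)"
  have P: "wk T # T # \<Gamma> \<turnstile> IsType ?P" using T by (rule path_form)
  have w: "T # \<Gamma> \<turnstile> IsType (wk T)" using T by (intro weaken_type)
  have t1: "?P # wk T # T # \<Gamma> \<turnstile> IsType B1" unfolding B1 by (intro weaken_type B w P)
  have t2: "?P # wk T # T # \<Gamma> \<turnstile> IsType B2" unfolding B2 by (intro weaken_type B' P)
  have C: "?P # wk T # T # \<Gamma> \<turnstile> IsType (arrow B1 B2)"
    by (intro pi_form weaken_type t1 t2)
  have r: "(\<lambda>k. (Refl (Var 0) \<cdot> Var 0 \<cdot> Var 0 \<cdot> shift 1) (Suc (upr Suc k))) = Var"
    by (auto simp: upr_def fun_eq_iff split: nat.split)
  have r': "(\<lambda>k. (Var 0 \<cdot> Var) (upr Suc k)) = Var"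
    by (auto simp: upr_def fun_eq_iff split: nat.split)
  \<comment> \<open>On the diagonal, with \<open>Refl\<close> for the path, both copies collapse to
    \<open>B\<close>, so the identity function is the base case.\<close>
  have s: "sub (Refl (Var 0) \<cdot> Var 0 \<cdot> Var 0 \<cdot> shift 1) (arrow B1 B2) = arrow B B"
    by (simp add: sub_ups_wk) (simp add: B1 B2 sub_ren r r' scons_shift)
  have "T # \<Gamma> \<turnstile> HasType (Lam B (Var 0)) (arrow B B)"
    by (intro lam B var_0)
  then have "\<Gamma> \<turnstile> HasType (IndEq (arrow B1 B2) (Lam B (Var 0)) x y e)
      (sub (e \<cdot> y \<cdot> x \<cdot> Var) (arrow B1 B2))"
    using C x y e s by (intro ind_eq) auto
  moreover have "sub (e \<cdot> y \<cdot> x \<cdot> Var) (arrow B1 B2) = arrow (inst B x) (inst B y)"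
  proof -
    have "(\<lambda>k. (e \<cdot> y \<cdot> x \<cdot> Var) (Suc (upr Suc k))) = y \<cdot> Var"
      by (auto simp: upr_def fun_eq_iff split: nat.split)
    then show ?thesis by (simp add: sub_ups_wk) (simp add: B1 B2 sub_ren)
  qed
  ultimately have "\<Gamma> \<turnstile> HasType (IndEq (arrow B1 B2) (Lam B (Var 0)) x y e)
      (arrow (inst B x) (inst B y))"
    by simp
  from app[OF this b] show ?thesis by (simp add: transport_def B1_def B2_def)
qed


section \<open>Arrows in an enumerated signature\<close>

text \<open>Sortedness excludes a smaller element to the right of a larger one.\<close>

lemma linear_extension_prefix:
  assumes "linear_extension lt S (ys @ zs)" "y \<in> set ys" "x \<in> S" "lt x y"
  shows "x \<in> set ys"
  using assms by (auto simp: linear_extension_def sorted_wrt_append)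

context folds_signature
begin

lemma outs_Ar: "f \<in> outs L K \<Longrightarrow> f \<in> Ar L \<and> src L f = K \<and> K \<in> Ob L \<and> tgt L f \<in> Ob L"
  using src_Ob tgt_Ob by (auto simp: outs_def)

text \<open>Were \<open>p \<bullet> f\<close> an identity, \<open>p\<close> would lead back to
  \<open>K\<close>, which \<open>no_return\<close> excludes.\<close>

lemma cmp_outs:
  assumes "f \<in> outs L K" "p \<in> outs L (tgt L f)"
  shows "p \<bullet> f \<in> outs L K" "tgt L (p \<bullet> f) = tgt L p"
proof -
  have f: "f \<in> Ar L" "src L f = K" "K \<in> Ob L" using outs_Ar[OF assms(1)] by auto
  have p: "p \<in> Ar L" "src L p = tgt L f" using outs_Ar[OF assms(2)] by auto
  show t: "tgt L (p \<bullet> f) = tgt L p" using f p by (simp add: tgt_cmp)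
  have "tgt L p \<noteq> K" using no_return[OF f(3) assms(1) p] .
  then have "p \<bullet> f \<noteq> ident L K" using t tgt_ident[OF f(3)] by auto
  then show "p \<bullet> f \<in> outs L K" using f p by (simp add: outs_def cmp_Ar src_cmp)
qed

lemma cmp_outs_assoc:
  "\<lbrakk>f \<in> outs L K; p \<in> outs L (tgt L f); q \<in> outs L (tgt L p)\<rbrakk> \<Longrightarrow> (q \<bullet> p) \<bullet> f = q \<bullet> (p \<bullet> f)"
  using outs_Ar by (metis cmp_assoc)

lemma cmp_outs_less: "\<lbrakk>f \<in> outs L K; p \<in> outs L (tgt L f)\<rbrakk> \<Longrightarrow> ar_less L (p \<bullet> f) f"
  using cmp_outs[of f K p] outs_Ar[of f K] outs_Ar[of "p \<bullet> f" K] ob_less_tgt[of "tgt L f" p]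
  by (auto intro: ar_less_tgt)

lemma cmp_outs_neq: "\<lbrakk>f \<in> outs L K; p \<in> outs L (tgt L f)\<rbrakk> \<Longrightarrow> p \<bullet> f \<noteq> f"
  using cmp_outs_less[of f K p] ar_order outs_Ar[of f K]
  by (auto simp: strict_partial_order_on_def)

text \<open>The type of the variable \<open>f\<close> mentions the variables
  \<open>p \<bullet> f\<close>. These are smaller than \<open>f\<close>, so a prefix contains all
  dependencies of its members.\<close>

lemma linear_extension_closed:
  assumes "linear_extension (ar_less L) (outs L K) (done @ fs)"
    and "f \<in> set done" "p \<in> outs L (tgt L f)"
  shows "p \<bullet> f \<in> set done"
proof -
  have f: "f \<in> outs L K" using assms(1,2) by (auto simp: linear_extension_def)
  show ?thesis
    using linear_extension_prefix[OF assms(1,2)] cmp_outs(1)[OF f assms(3)]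
      cmp_outs_less[OF f assms(3)]
    by blast
qed

lemma linear_extension_next:
  assumes "linear_extension (ar_less L) (outs L K) (done @ f # fs)" "p \<in> outs L (tgt L f)"
  shows "p \<bullet> f \<in> set done"
proof -
  have "p \<bullet> f \<in> set (done @ [f])"
    using assms by (intro linear_extension_closed[of K _ fs f p]) auto
  moreover have "p \<bullet> f \<noteq> f"
    using assms cmp_outs_neq[of f K p] by (auto simp: linear_extension_def)
  ultimately show ?thesis by simp
qed

end

text \<open>Only non-logical sorts take arguments through \<open>apply_sort\<close>, so the
  enumerations are constrained only there.\<close>

locale enumerated_h_signature = h_signature L
  for L :: "('o, 'a, 'm) h_sig_scheme" (structure) +
  fixes en :: "'o \<Rightarrow> 'a list"
  assumes en: "K \<in> NL L \<Longrightarrow> linear_extension (ar_less L) (outs L K) (en K)"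
begin

lemma set_en: "K \<in> NL L \<Longrightarrow> set (en K) = outs L K"
  using en by (auto simp: linear_extension_def)

text \<open>The components that the type of \<open>X\<close> may consult: its own, if it is
  non-logical, and those reached through its arguments.\<close>

definition below :: "'o \<Rightarrow> 'o set" where
  "below X = NL L \<inter> insert X (tgt L ` outs L X)"

text \<open>A composite has the codomain of its last factor, so nothing new is reached through
  \<open>f\<close>. The bound leaves out \<open>X\<close>: argument types of a component refer only
  to smaller components.\<close>

lemma below_tgt:
  assumes "f \<in> outs L X"
  shows "below (tgt L f) \<subseteq> NL L \<inter> tgt L ` outs L X"
proof
  fix K assume "K \<in> below (tgt L f)"
  then consider "K = tgt L f" "K \<in> NL L"
    | p where "K \<in> NL L" "p \<in> outs L (tgt L f)" "K = tgt L p"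
    by (auto simp: below_def)
  then show "K \<in> NL L \<inter> tgt L ` outs L X"
    using assms cmp_outs[OF assms] by cases (auto, metis imageI)
qed

lemma below_mono: "f \<in> outs L X \<Longrightarrow> below (tgt L f) \<subseteq> below X"
  using below_tgt[of f X] by (auto simp: below_def)

lemma self_below: "X \<in> NL L \<Longrightarrow> X \<in> below X"
  by (simp add: below_def)

section \<open>Arrows out of the logical sorts and their equations\<close>

lemma iso_arrows:
  assumes "X \<in> Ob L" "label L X = IsoOf A"
  shows "sA L A \<in> outs L X" "tA L A \<in> outs L X" "tgt L (sA L A) = A" "tgt L (tA L A) = A"
    "p \<in> outs L A \<Longrightarrow> p \<bullet> tA L A = p \<bullet> sA L A"
proof -
  have *: "sA L A \<in> top_arrows L X" "tA L A \<in> top_arrows L X"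
    "sA L A \<in> {f \<in> Ar L. src L f = X \<and> tgt L f = A}" "tA L A \<in> {f \<in> Ar L. src L f = X \<and> tgt L f = A}"
    using iso_sort[OF assms] by auto
  then show "sA L A \<in> outs L X" "tA L A \<in> outs L X" "tgt L (sA L A) = A" "tgt L (tA L A) = A"
    by (auto simp: top_arrows_def top_level_def)
  show "p \<in> outs L A \<Longrightarrow> p \<bullet> tA L A = p \<bullet> sA L A" using iso_sort[OF assms] by auto
qed

lemma refl_arrows:
  assumes "X \<in> Ob L" "label L X = ReflOf A"
  shows "rA L A \<in> outs L X" "tgt L (rA L A) \<in> Ob L" "label L (tgt L (rA L A)) = IsoOf A"
    "tA L A \<bullet> rA L A = sA L A \<bullet> rA L A"
  using refl_out[OF assms] refl_sort[OF assms] outs_Ar by auto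

text \<open>The last clause unpacks top-levelness of \<open>g\<close>; it keeps the variable of
  \<open>g\<close> out of the argument types of \<open>src L g\<close>.\<close>

lemma trans_arrows:
  assumes "X \<in> Ob L" "label L X = TransOf g"
  shows "arr1 L g \<in> outs L X" "arr2 L g \<in> outs L X" "eA L g \<in> outs L X"
    "tgt L (arr1 L g) = src L g" "tgt L (arr2 L g) = src L g"
    "tgt L (eA L g) \<in> Ob L" "label L (tgt L (eA L g)) = IsoOf (tgt L g)"
    "sA L (tgt L g) \<bullet> eA L g = g \<bullet> arr1 L g" "tA L (tgt L g) \<bullet> eA L g = g \<bullet> arr2 L g"
    "\<lbrakk>p \<in> outs L (src L g); p \<noteq> g\<rbrakk> \<Longrightarrow> p \<bullet> arr2 L g = p \<bullet> arr1 L g"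
    "g \<in> outs L (src L g)"
    "\<lbrakk>p \<in> outs L (src L g); q \<in> outs L (tgt L p)\<rbrakk> \<Longrightarrow> q \<bullet> p \<noteq> g"
proof -
  note t = trans_sort[OF assms]
  have top: "arr1 L g \<in> top_arrows L X" "arr2 L g \<in> top_arrows L X" "eA L g \<in> top_arrows L X"
    using t by auto
  then show "arr1 L g \<in> outs L X" "arr2 L g \<in> outs L X" and e: "eA L g \<in> outs L X"
    by (auto simp: top_arrows_def top_level_def)
  show "tgt L (eA L g) \<in> Ob L" using outs_Ar[OF e] by simp
  have "top_level L g" using t by blast
  then show "g \<in> outs L (src L g)"
    "\<lbrakk>p \<in> outs L (src L g); q \<in> outs L (tgt L p)\<rbrakk> \<Longrightarrow> q \<bullet> p \<noteq> g"
    unfolding top_level_def by auto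
qed (use trans_sort[OF assms] in auto)


section \<open>The sort types under substitution\<close>

text \<open>Recursive calls of \<open>hat\<close> run along arrows out of \<open>X\<close> and
  consult only composites with them. The induction uses the termination measure of
  \<open>hat\<close>.\<close>

lemma hat_cong:
  assumes "\<And>p. p \<in> outs L X \<Longrightarrow> \<sigma> p = \<sigma>' p"
    and "\<And>K. K \<in> below X \<Longrightarrow> \<eta> K = \<eta>' K"
  shows "hat en \<eta> \<sigma> X = hat en \<eta>' \<sigma>' X"
  using assms
proof (induction X arbitrary: \<eta> \<eta>' \<sigma> \<sigma>'
    rule: measure_induct_rule[where f = "\<lambda>X. card (tgt L ` {g \<in> Ar L. src L g = X})"])
  case (less X)
  show ?case
  proof (cases "X \<in> Ob L")
    case X: True
    \<comment> \<open>The environments are arbitrary, so this also serves the call below the fresh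
      variable in the clause for \<open>\<tau>\<close>.\<close>
    have step: "hat en \<zeta> \<theta> (tgt L f) = hat en \<zeta>' \<theta>' (tgt L f)"
      if "f \<in> outs L X" "\<And>p. p \<in> outs L (tgt L f) \<Longrightarrow> \<theta> p = \<theta>' p"
        "\<And>K. K \<in> below X \<Longrightarrow> \<zeta> K = \<zeta>' K" for f \<zeta> \<zeta>' \<theta> \<theta>'
      using less.IH[OF card_out_less[OF X that(1)], of \<theta> \<theta>' \<zeta> \<zeta>'] that below_mono[OF that(1)] by blast
    show ?thesis
    proof (cases "label L X")
      case NonLogical
      then have N: "X \<in> NL L" using X by (simp add: NL_def)
      have "apply_sort en \<eta> \<sigma> X = apply_sort en \<eta>' \<sigma>' X"
        using less.prems(1) less.prems(2)[OF self_below[OF N]] N foldl_App_cong[of "en X" \<sigma> \<sigma>']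
        by (simp add: apply_sort_def set_en)
      then show ?thesis using X NonLogical by (simp add: hat.simps)
    next
      case (IsoOf A)
      note a = iso_arrows[OF X IsoOf]
      have "hat en \<eta> (\<lambda>p. \<sigma> (p \<bullet> sA L A)) (tgt L (sA L A)) =
          hat en \<eta>' (\<lambda>p. \<sigma>' (p \<bullet> sA L A)) (tgt L (sA L A))"
        using a cmp_outs less.prems by (intro step) auto
      then show ?thesis using X IsoOf a less.prems(1)
        by (simp add: hat.simps[of _ _ _ X])
    next
      case (ReflOf A)
      note a = refl_arrows[OF X ReflOf]
      have "hat en \<eta> (\<lambda>p. \<sigma> (p \<bullet> rA L A)) (tgt L (rA L A)) =
          hat en \<eta>' (\<lambda>p. \<sigma>' (p \<bullet> rA L A)) (tgt L (rA L A))"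
        using a cmp_outs less.prems by (intro step) auto
      moreover have "sA L A \<bullet> rA L A \<in> outs L X"
        using iso_arrows[OF a(2,3)] a cmp_outs by auto
      ultimately show ?thesis using X ReflOf a less.prems(1)
        by (simp add: hat.simps[of _ _ _ X])
    next
      case (TransOf g)
      note a = trans_arrows[OF X TransOf]
      have "hat en \<eta> (\<lambda>p. \<sigma> (p \<bullet> arr2 L g)) (tgt L (arr2 L g)) =
          hat en \<eta>' (\<lambda>p. \<sigma>' (p \<bullet> arr2 L g)) (tgt L (arr2 L g))"
        using a cmp_outs less.prems by (intro step) auto
      moreover have "hat en (\<lambda>K. wk (\<eta> K)) ((\<lambda>p. wk (\<sigma> (p \<bullet> arr1 L g)))(g := Var 0)) (tgt L (arr1 L g)) =
          hat en (\<lambda>K. wk (\<eta>' K)) ((\<lambda>p. wk (\<sigma>' (p \<bullet> arr1 L g)))(g := Var 0)) (tgt L (arr1 L g))"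
        using a cmp_outs less.prems by (intro step) auto
      moreover have "g \<bullet> arr1 L g \<in> outs L X" "g \<bullet> arr2 L g \<in> outs L X"
        using a cmp_outs by auto
      ultimately show ?thesis using X TransOf a less.prems(1)
        by (simp add: hat.simps[of _ _ _ X])
    qed
  qed (simp add: hat.simps)
qed

text \<open>Free indices enter \<open>hat\<close> only through the two environments, so a
  substitution can be pushed into them.\<close>

lemma sub_hat: "sub \<tau> (hat en \<eta> \<sigma> X) = hat en (\<lambda>K. sub \<tau> (\<eta> K)) (\<lambda>p. sub \<tau> (\<sigma> p)) X"
proof (induction X arbitrary: \<tau> \<eta> \<sigma>
    rule: measure_induct_rule[where f = "\<lambda>X. card (tgt L ` {g \<in> Ar L. src L g = X})"])
  case (less X)
  show ?case
  proof (cases "X \<in> Ob L")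
    case X: True
    have step: "sub \<tau> (hat en \<eta> \<sigma> (tgt L f)) = hat en (\<lambda>K. sub \<tau> (\<eta> K)) (\<lambda>p. sub \<tau> (\<sigma> p)) (tgt L f)"
      if "f \<in> outs L X" for f \<tau> \<eta> \<sigma>
      using less.IH[OF card_out_less[OF X that]] .
    show ?thesis
    proof (cases "label L X")
      case NonLogical
      then show ?thesis using X by (simp add: hat.simps sub_ElH apply_sort_def sub_foldl_App)
    next
      case (IsoOf A)
      note a = iso_arrows[OF X IsoOf]
      show ?thesis using X IsoOf step[OF a(1)] a by (simp add: hat.simps[of _ _ _ X])
    next
      case (ReflOf A)
      note a = refl_arrows[OF X ReflOf]
      show ?thesis using X ReflOf step[OF a(1)] by (simp add: hat.simps[of _ _ _ X])
    next
      case (TransOf g)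
      note a = trans_arrows[OF X TransOf]
      have "sub (ups \<tau>) (hat en (\<lambda>K. wk (\<eta> K)) ((\<lambda>p. wk (\<sigma> (p \<bullet> arr1 L g)))(g := Var 0)) (src L g)) =
          hat en (\<lambda>K. wk (sub \<tau> (\<eta> K))) ((\<lambda>p. wk (sub \<tau> (\<sigma> (p \<bullet> arr1 L g))))(g := Var 0)) (src L g)"
        unfolding step[OF a(1), unfolded a(4)] ups_fun_upd[of \<tau> "\<lambda>p. \<sigma> (p \<bullet> arr1 L g)"] sub_ups_wk ..
      then show ?thesis using X TransOf step[OF a(1)] a(4)
        by (simp add: hat.simps[of _ _ _ X] sub_transport)
    qed
  qed (simp add: hat.simps)
qed

lemma wk_hat: "wk (hat en \<eta> \<sigma> X) = hat en (\<lambda>K. wk (\<eta> K)) (\<lambda>p. wk (\<sigma> p)) X"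
  by (simp add: ren_eq_sub sub_hat)


section \<open>Component types under substitution and change of environment\<close>

lemma sub_pis:
  assumes "\<And>\<tau>. sub \<tau> B = B"
  shows "sub \<tau> (pis en \<eta> \<sigma> B fs) = pis en (\<lambda>K. sub \<tau> (\<eta> K)) (\<lambda>p. sub \<tau> (\<sigma> p)) B fs"
proof (induction fs arbitrary: \<tau> \<eta> \<sigma>)
  case (Cons f fs)
  then show ?case by (simp add: sub_hat Cons sub_ups_wk ups_fun_upd del: fun_upd_apply)
qed (simp add: assms)

lemma sub_sort_type: "sub \<tau> (sort_type en \<eta> K) = sort_type en (\<lambda>K. sub \<tau> (\<eta> K)) K"
  by (simp add: sort_type_def sub_pis)

lemma wk_sort_type: "wk (sort_type en \<eta> K) = sort_type en (\<lambda>K. wk (\<eta> K)) K"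
  by (simp add: ren_eq_sub sub_sort_type)

lemma pis_cong:
  assumes "\<And>f K. \<lbrakk>f \<in> set fs; K \<in> below (tgt L f)\<rbrakk> \<Longrightarrow> \<eta> K = \<eta>' K"
  shows "pis en \<eta> \<sigma> B fs = pis en \<eta>' \<sigma> B fs"
  using assms
proof (induction fs arbitrary: \<eta> \<eta>' \<sigma>)
  case (Cons f fs)
  have "hat en \<eta> (\<lambda>p. \<sigma> (p \<bullet> f)) (tgt L f) = hat en \<eta>' (\<lambda>p. \<sigma> (p \<bullet> f)) (tgt L f)"
    using Cons.prems[of f] by (intro hat_cong) auto
  moreover have "pis en (\<lambda>K. wk (\<eta> K)) \<theta> B fs = pis en (\<lambda>K. wk (\<eta>' K)) \<theta> B fs" for \<theta>
    using Cons.prems by (intro Cons.IH) (metis list.set_intros(2))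
  ultimately show ?case by simp
qed simp

text \<open>By \<open>below_tgt\<close> the argument types consult only components below
  \<open>K\<close>, so variables for other sorts may be introduced freely.\<close>

lemma sort_type_cong:
  assumes "K \<in> NL L" "\<And>K'. K' \<in> NL L \<inter> tgt L ` outs L K \<Longrightarrow> \<eta> K' = \<eta>' K'"
  shows "sort_type en \<eta> K = sort_type en \<eta>' K"
proof -
  have "pis en \<eta> (\<lambda>_. Star) B (en K) = pis en \<eta>' (\<lambda>_. Star) B (en K)" for B
    using assms below_tgt set_en[OF assms(1)] by (intro pis_cong) blast
  then show ?thesis by (simp add: sort_type_def)
qed


section \<open>Derivability of the sort types\<close>

text \<open>\<open>F\<close> is a parameter because validity is also needed for just the arrows
  introduced so far, and for all arrows but one.\<close>

definition arrows_ok :: "expr list \<Rightarrow> ('o \<Rightarrow> expr) \<Rightarrow> ('a \<Rightarrow> expr) \<Rightarrow> 'a set \<Rightarrow> bool" where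
  "arrows_ok \<Gamma> \<eta> \<sigma> F \<longleftrightarrow> (\<forall>f \<in> F. \<Gamma> \<turnstile> HasType (\<sigma> f) (hat en \<eta> (\<lambda>p. \<sigma> (p \<bullet> f)) (tgt L f)))"

definition sorts_ok :: "expr list \<Rightarrow> ('o \<Rightarrow> expr) \<Rightarrow> 'o set \<Rightarrow> bool" where
  "sorts_ok \<Gamma> \<eta> S \<longleftrightarrow> (\<forall>K \<in> S. \<Gamma> \<turnstile> HasType (\<eta> K) (sort_type en \<eta> K))"

lemma sorts_okD: "\<lbrakk>sorts_ok \<Gamma> \<eta> S; K \<in> S\<rbrakk> \<Longrightarrow> \<Gamma> \<turnstile> HasType (\<eta> K) (sort_type en \<eta> K)"
  by (simp add: sorts_ok_def)

lemma sorts_ok_mono: "\<lbrakk>sorts_ok \<Gamma> \<eta> S; S' \<subseteq> S\<rbrakk> \<Longrightarrow> sorts_ok \<Gamma> \<eta> S'"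
  by (auto simp: sorts_ok_def)

lemma arrows_okD:
  "\<lbrakk>arrows_ok \<Gamma> \<eta> \<sigma> F; f \<in> F\<rbrakk> \<Longrightarrow> \<Gamma> \<turnstile> HasType (\<sigma> f) (hat en \<eta> (\<lambda>p. \<sigma> (p \<bullet> f)) (tgt L f))"
  by (simp add: arrows_ok_def)

lemma sorts_ok_wk:
  "\<lbrakk>sorts_ok \<Gamma> \<eta> S; \<Gamma> \<turnstile> IsType A\<rbrakk> \<Longrightarrow> sorts_ok (A # \<Gamma>) (\<lambda>K. wk (\<eta> K)) S"
  unfolding sorts_ok_def wk_sort_type[symmetric] by (auto intro: weaken_term)

lemma arrows_ok_wk:
  "\<lbrakk>arrows_ok \<Gamma> \<eta> \<sigma> F; \<Gamma> \<turnstile> IsType A\<rbrakk> \<Longrightarrow> arrows_ok (A # \<Gamma>) (\<lambda>K. wk (\<eta> K)) (\<lambda>p. wk (\<sigma> p)) F"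
  unfolding arrows_ok_def wk_hat[symmetric] by (auto intro: weaken_term)

text \<open>Associativity identifies the type of \<open>p \<bullet> f\<close> as an arrow out of
  \<open>X\<close> with that of \<open>p\<close> under the precomposed assignment.\<close>

lemma arrows_ok_cmp:
  assumes "arrows_ok \<Gamma> \<eta> \<sigma> F" "f \<in> outs L X" "\<And>p. p \<in> outs L (tgt L f) \<Longrightarrow> p \<bullet> f \<in> F"
  shows "arrows_ok \<Gamma> \<eta> (\<lambda>p. \<sigma> (p \<bullet> f)) (outs L (tgt L f))"
  unfolding arrows_ok_def
proof
  fix p assume p: "p \<in> outs L (tgt L f)"
  have "hat en \<eta> (\<lambda>q. \<sigma> (q \<bullet> (p \<bullet> f))) (tgt L (p \<bullet> f)) = hat en \<eta> (\<lambda>q. \<sigma> (q \<bullet> p \<bullet> f)) (tgt L p)"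
    unfolding cmp_outs(2)[OF assms(2) p]
    using cmp_outs_assoc[OF assms(2) p] by (intro hat_cong) auto
  then show "\<Gamma> \<turnstile> HasType (\<sigma> (p \<bullet> f)) (hat en \<eta> (\<lambda>q. \<sigma> (q \<bullet> p \<bullet> f)) (tgt L p))"
    using arrows_okD[OF assms(1) assms(3)[OF p]] by simp
qed

text \<open>No composite equals \<open>f\<close>, so no type involved mentions the overwritten
  variable. The first premise leaves \<open>f\<close> out: its old value may be a dummy, as in
  \<open>pis\<close>, or a term being replaced, as in the clause for \<open>\<tau>\<close>.\<close>

lemma arrows_ok_upd:
  assumes "arrows_ok \<Gamma> \<eta> \<sigma> (F - {f})"
    and T: "\<Gamma> \<turnstile> IsType (hat en \<eta> (\<lambda>p. \<sigma> (p \<bullet> f)) (tgt L f))" (is "_ \<turnstile> IsType ?T")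
    and "f \<in> outs L X"
    and "\<And>p q. \<lbrakk>p \<in> F; q \<in> outs L (tgt L p)\<rbrakk> \<Longrightarrow> q \<bullet> p \<noteq> f"
  shows "arrows_ok (?T # \<Gamma>) (\<lambda>K. wk (\<eta> K)) ((\<lambda>p. wk (\<sigma> p))(f := Var 0)) F"
  unfolding arrows_ok_def
proof
  fix p assume p: "p \<in> F"
  let ?\<theta> = "(\<lambda>p. wk (\<sigma> p))(f := Var 0)"
  have "hat en (\<lambda>K. wk (\<eta> K)) (\<lambda>q. ?\<theta> (q \<bullet> p)) (tgt L p) =
      wk (hat en \<eta> (\<lambda>q. \<sigma> (q \<bullet> p)) (tgt L p))"
    unfolding wk_hat using assms(4)[OF p] by (intro hat_cong) auto
  then show "?T # \<Gamma> \<turnstile> HasType (?\<theta> p) (hat en (\<lambda>K. wk (\<eta> K)) (\<lambda>q. ?\<theta> (q \<bullet> p)) (tgt L p))"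
    using var_0[OF T] weaken_term[OF arrows_okD[OF assms(1)] T, of p] p by auto
qed

text \<open>\<open>\<sigma>'\<close> is the assignment under which the remaining
  \<open>\<Pi>\<close> type is formed. It agrees with \<open>\<sigma>\<close> on the arguments
  already supplied, which are all that the next argument type consults.\<close>

lemma foldl_App_type:
  assumes "linear_extension (ar_less L) (outs L K) (done @ fs)"
    and "arrows_ok \<Gamma> \<eta> \<sigma> (outs L K)"
    and "\<And>f. f \<in> set done \<Longrightarrow> \<sigma>' f = \<sigma> f"
    and "\<And>\<tau>. sub \<tau> B = B"
    and "\<Gamma> \<turnstile> HasType u (pis en \<eta> \<sigma>' B fs)"
  shows "\<Gamma> \<turnstile> HasType (foldl (\<lambda>u p. App u (\<sigma> p)) u fs) B"
  using assms(1,3,5)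
proof (induction fs arbitrary: "done" \<sigma>' u)
  case (Cons f fs)
  have f: "f \<in> outs L K" using Cons.prems(1) by (auto simp: linear_extension_def)
  have "hat en \<eta> (\<lambda>p. \<sigma>' (p \<bullet> f)) (tgt L f) = hat en \<eta> (\<lambda>p. \<sigma> (p \<bullet> f)) (tgt L f)"
    using Cons.prems(2) linear_extension_next[OF Cons.prems(1)] by (intro hat_cong) auto
  then have "\<Gamma> \<turnstile> HasType u (Pi (hat en \<eta> (\<lambda>p. \<sigma> (p \<bullet> f)) (tgt L f))
        (pis en (\<lambda>K. wk (\<eta> K)) ((\<lambda>p. wk (\<sigma>' p))(f := Var 0)) B fs))"
    using Cons.prems(3) by simp
  from app[OF this arrows_okD[OF assms(2) f]]
  have "\<Gamma> \<turnstile> HasType (App u (\<sigma> f))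
      (inst (pis en (\<lambda>K. wk (\<eta> K)) ((\<lambda>p. wk (\<sigma>' p))(f := Var 0)) B fs) (\<sigma> f))" .
  \<comment> \<open>Instantiating index 0 undoes the weakenings and records
    \<open>\<sigma> f\<close> as the value of \<open>f\<close>.\<close>
  moreover have "(\<lambda>p. sub (\<sigma> f \<cdot> Var) (((\<lambda>p. wk (\<sigma>' p))(f := Var 0)) p)) = \<sigma>'(f := \<sigma> f)"
    by (auto simp: fun_eq_iff)
  ultimately have "\<Gamma> \<turnstile> HasType (App u (\<sigma> f)) (pis en \<eta> (\<sigma>'(f := \<sigma> f)) B fs)"
    by (simp add: sub_pis[OF assms(4)] del: fun_upd_apply)
  moreover have "(\<sigma>'(f := \<sigma> f)) p = \<sigma> p" if "p \<in> set (done @ [f])" for p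
    using that Cons.prems(2) by auto
  ultimately show ?case
    using Cons.IH[of "done @ [f]" "\<sigma>'(f := \<sigma> f)" "App u (\<sigma> f)"] Cons.prems(1)
    by (simp del: fun_upd_apply)
qed simp

lemma apply_sort_type:
  assumes "\<Gamma> \<turnstile> IsCtx" "X \<in> NL L" "arrows_ok \<Gamma> \<eta> \<sigma> (outs L X)"
    and "\<Gamma> \<turnstile> HasType (\<eta> X) (sort_type en \<eta> X)"
  shows "\<Gamma> \<turnstile> HasType (apply_sort en \<eta> \<sigma> X) (UnivH (hl L X))"
proof (cases "en X = []")
  case True
  then have "\<Gamma> \<turnstile> HasType (\<eta> X) (arrow Unit (UnivH (hl L X)))"
    using assms(4) by (simp add: sort_type_def)
  from app[OF this star[OF assms(1)]] show ?thesis using True by (simp add: apply_sort_def)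
next
  case False
  then show ?thesis
    using foldl_App_type[of X "[]" "en X" \<Gamma> \<eta> \<sigma> "\<lambda>_. Star" "UnivH (hl L X)" "\<eta> X"] assms en
    by (simp add: apply_sort_def sort_type_def)
qed

text \<open>Context and environments stay general in the induction, since the family for transport
  is formed below a fresh variable.\<close>

lemma hat_form:
  assumes "X \<in> Ob L" "\<Gamma> \<turnstile> IsCtx" "arrows_ok \<Gamma> \<eta> \<sigma> (outs L X)" "sorts_ok \<Gamma> \<eta> (below X)"
  shows "\<Gamma> \<turnstile> IsType (hat en \<eta> \<sigma> X)"
  using assms
proof (induction X arbitrary: \<Gamma> \<eta> \<sigma>
    rule: measure_induct_rule[where f = "\<lambda>X. card (tgt L ` {g \<in> Ar L. src L g = X})"])
  case (less X)
  note X = less.prems(1) and ctx = less.prems(2) and ar = less.prems(3) and so = less.prems(4)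
  have step: "\<Delta> \<turnstile> IsType (hat en \<zeta> \<theta> (tgt L f))"
    if "f \<in> outs L X" "\<Delta> \<turnstile> IsCtx" "arrows_ok \<Delta> \<zeta> \<theta> (outs L (tgt L f))" "sorts_ok \<Delta> \<zeta> (below X)"
    for f \<Delta> \<zeta> \<theta>
    using less.IH[OF card_out_less[OF X that(1)] _ that(2,3)] that(1)
      sorts_ok_mono[OF that(4) below_mono[OF that(1)]] outs_Ar by blast
  have ar_cmp: "arrows_ok \<Gamma> \<eta> (\<lambda>p. \<sigma> (p \<bullet> f)) (outs L (tgt L f))" if "f \<in> outs L X" for f
    using cmp_outs(1)[OF that] by (intro arrows_ok_cmp[OF ar that])
  have ty: "\<Gamma> \<turnstile> IsType (hat en \<eta> (\<lambda>p. \<sigma> (p \<bullet> f)) (tgt L f))" if "f \<in> outs L X" for f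
    using step[OF that ctx ar_cmp[OF that] so] .
  show ?case
  proof (cases "label L X")
    case NonLogical
    then have N: "X \<in> NL L" using X by (simp add: NL_def)
    show ?thesis
      using ElH_form[OF ctx apply_sort_type[OF ctx N ar sorts_okD[OF so self_below[OF N]]]] X NonLogical
      by (simp add: hat.simps)
  next
    case (IsoOf A)
    note a = iso_arrows[OF X IsoOf]
    \<comment> \<open>Arrows out of \<open>A\<close> compose equally with both arrows to
      \<open>A\<close>, so the two endpoints have the same type.\<close>
    have "hat en \<eta> (\<lambda>p. \<sigma> (p \<bullet> tA L A)) A = hat en \<eta> (\<lambda>p. \<sigma> (p \<bullet> sA L A)) A"
      using a(5) by (intro hat_cong) auto
    then have "\<Gamma> \<turnstile> IsType (Eq (hat en \<eta> (\<lambda>p. \<sigma> (p \<bullet> sA L A)) A) (\<sigma> (sA L A)) (\<sigma> (tA L A)))"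
      using ty[OF a(1)] arrows_okD[OF ar a(1)] arrows_okD[OF ar a(2)] a(3,4) by (intro eq_form) auto
    then show ?thesis using X IsoOf by (simp add: hat.simps[of _ _ _ X])
  next
    case (ReflOf A)
    note r = refl_arrows[OF X ReflOf]
    note a = iso_arrows[OF r(2,3)]
    let ?H = "hat en \<eta> (\<lambda>p. \<sigma> (p \<bullet> rA L A)) (tgt L (rA L A))"
    \<comment> \<open>The equation for \<open>rA L A\<close> turns this into the identity type of
      one term with itself, which \<open>Refl\<close> inhabits.\<close>
    have "?H = Eq (hat en \<eta> (\<lambda>p. \<sigma> (p \<bullet> sA L A \<bullet> rA L A)) A) (\<sigma> (sA L A \<bullet> rA L A)) (\<sigma> (sA L A \<bullet> rA L A))"
      using r by (simp add: hat.simps[of _ _ _ "tgt L (rA L A)"])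
    moreover have "\<Gamma> \<turnstile> HasType (\<sigma> (sA L A \<bullet> rA L A)) (hat en \<eta> (\<lambda>p. \<sigma> (p \<bullet> sA L A \<bullet> rA L A)) A)"
      using arrows_okD[OF ar_cmp[OF r(1)] a(1)] a(3) by simp
    ultimately have "\<Gamma> \<turnstile> HasType (Refl (\<sigma> (sA L A \<bullet> rA L A))) ?H"
      by (simp add: refl)
    then have "\<Gamma> \<turnstile> IsType (Eq ?H (\<sigma> (rA L A)) (Refl (\<sigma> (sA L A \<bullet> rA L A))))"
      using ty[OF r(1)] arrows_okD[OF ar r(1)] by (intro eq_form)
    then show ?thesis using X ReflOf by (simp add: hat.simps[of _ _ _ X])
  next
    case (TransOf g)
    note a = trans_arrows[OF X TransOf]
    define A where "A = src L g"
    \<comment> \<open>\<open>\<theta>\<close> and \<open>\<theta>'\<close> assign the arguments of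
      \<open>A\<close> along the two parallel arrows; \<open>T\<close> is the type of the argument
      at \<open>g\<close>, and \<open>B\<close> the family in which that argument varies.\<close>
    define \<theta> where "\<theta> = (\<lambda>p. \<sigma> (p \<bullet> arr1 L g))"
    define \<theta>' where "\<theta>' = (\<lambda>p. \<sigma> (p \<bullet> arr2 L g))"
    define T where "T = hat en \<eta> (\<lambda>p. \<theta> (p \<bullet> g)) (tgt L g)"
    define B where "B = hat en (\<lambda>K. wk (\<eta> K)) ((\<lambda>p. wk (\<theta> p))(g := Var 0)) A"
    have g: "g \<in> outs L A" using a(11) by (simp add: A_def)
    have g1: "g \<bullet> arr1 L g \<in> outs L X" "tgt L (g \<bullet> arr1 L g) = tgt L g"
      using cmp_outs[OF a(1)] g a(4) by (auto simp: A_def)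
    have top: "q \<bullet> p \<noteq> g" if "p \<in> outs L A" "q \<in> outs L (tgt L p)" for p q
      using a(12) that by (simp add: A_def)
    have \<theta>: "arrows_ok \<Gamma> \<eta> \<theta> (outs L A)" and \<theta>': "arrows_ok \<Gamma> \<eta> \<theta>' (outs L A)"
      using ar_cmp[OF a(1)] ar_cmp[OF a(2)] a(4,5) by (auto simp: \<theta>_def \<theta>'_def A_def)
    have \<theta>\<theta>': "\<theta>' p = \<theta> p" if "p \<in> outs L A" "p \<noteq> g" for p
      using a(10) that by (simp add: \<theta>_def \<theta>'_def A_def)
    \<comment> \<open>Stated for all contexts because \<open>transport_type\<close> needs the family over \<open>\<Gamma>\<close> and over \<open>T # \<Gamma>\<close>.\<close>
    have B_form: "\<Delta> \<turnstile> IsType (hat en \<zeta> (\<lambda>p. \<psi> (p \<bullet> g)) (tgt L g)) \<Longrightarrow>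
        hat en \<zeta> (\<lambda>p. \<psi> (p \<bullet> g)) (tgt L g) # \<Delta> \<turnstile>
          IsType (hat en (\<lambda>K. wk (\<zeta> K)) ((\<lambda>p. wk (\<psi> p))(g := Var 0)) A)"
      if "arrows_ok \<Delta> \<zeta> \<psi> (outs L A)" "sorts_ok \<Delta> \<zeta> (below X)" for \<Delta> \<zeta> \<psi>
    proof -
      assume T: "\<Delta> \<turnstile> IsType (hat en \<zeta> (\<lambda>p. \<psi> (p \<bullet> g)) (tgt L g))"
      have "arrows_ok \<Delta> \<zeta> \<psi> (outs L A - {g})" using that(1) by (auto simp: arrows_ok_def)
      from arrows_ok_upd[OF this T g top] show ?thesis
        using step[OF a(1), unfolded a(4), folded A_def] ctx_ext[OF T] sorts_ok_wk[OF that(2) T]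
        by blast
    qed
    \<comment> \<open>\<open>step\<close> speaks of arrows out of \<open>X\<close>, so
      \<open>tgt L g\<close> is reached through \<open>g \<bullet> arr1 L g\<close>.\<close>
    have T: "\<Gamma> \<turnstile> IsType T"
      unfolding T_def
      using step[OF g1(1) ctx] arrows_ok_cmp[OF \<theta> g] cmp_outs(1)[OF g] so g1(2) by simp
    have B: "T # \<Gamma> \<turnstile> IsType B"
      unfolding B_def T_def using T by (intro B_form \<theta> so) (simp add: T_def)
    have wT: "wk T = hat en (\<lambda>K. wk (\<eta> K)) (\<lambda>p. wk (\<theta> (p \<bullet> g))) (tgt L g)"
      by (simp add: T_def wk_hat)
    \<comment> \<open>Weakening \<open>B\<close> below \<open>v\<close> gives the family built from
      the weakened environments, to which \<open>B_form\<close> applies over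
      \<open>T # \<Gamma>\<close>.\<close>
    have B': "wk T # T # \<Gamma> \<turnstile> IsType (ren (upr Suc) B)"
    proof -
      have u: "ren (upr Suc) (wk t) = wk (wk t)" for t
        by (simp add: ren_ren upr_def)
      have "(\<lambda>p. ren (upr Suc) (((\<lambda>p. wk (\<theta> p))(g := Var 0)) p)) = (\<lambda>p. wk (wk (\<theta> p)))(g := Var 0)"
        by (auto simp: fun_eq_iff u) (simp add: upr_def)
      then have "ren (upr Suc) B = hat en (\<lambda>K. wk (wk (\<eta> K))) ((\<lambda>p. wk (wk (\<theta> p)))(g := Var 0)) A"
        by (simp add: B_def ren_eq_sub[of "upr Suc"] sub_hat u[unfolded ren_eq_sub[of "upr Suc"]] del: fun_upd_apply)
      then show ?thesis
        using B_form[OF arrows_ok_wk[OF \<theta> T] sorts_ok_wk[OF so T]] weaken_type[OF T T]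
        unfolding wT by simp
    qed
    have x: "\<Gamma> \<turnstile> HasType (\<theta> g) T"
      using arrows_okD[OF \<theta> g] by (simp add: T_def)
    \<comment> \<open>The composites \<open>p \<bullet> g\<close> differ from \<open>g\<close>, so
      \<open>\<theta>\<close> and \<open>\<theta>'\<close> agree on them.\<close>
    have "hat en \<eta> (\<lambda>p. \<theta>' (p \<bullet> g)) (tgt L g) = T"
      unfolding T_def using \<theta>\<theta>' cmp_outs(1)[OF g] cmp_outs_neq[OF g] by (intro hat_cong) auto
    then have y: "\<Gamma> \<turnstile> HasType (\<theta>' g) T"
      using arrows_okD[OF \<theta>' g] by simp
    \<comment> \<open>The codomain of \<open>eA L g\<close> is the isomorphism sort of
      \<open>tgt L g\<close>; its endpoints, composed with \<open>eA L g\<close>, are the two values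
      at \<open>g\<close>.\<close>
    have e: "\<Gamma> \<turnstile> HasType (\<sigma> (eA L g)) (Eq T (\<theta> g) (\<theta>' g))"
    proof -
      note i = iso_arrows[OF a(6,7)]
      have "p \<bullet> sA L (tgt L g) \<bullet> eA L g = p \<bullet> g \<bullet> arr1 L g" if "p \<in> outs L (tgt L g)" for p
        using cmp_outs_assoc[OF a(3) i(1), of p] cmp_outs_assoc[OF a(1), of g p] that a(4,8,11) i(3)
        by simp
      then have "hat en \<eta> (\<lambda>p. \<sigma> (p \<bullet> sA L (tgt L g) \<bullet> eA L g)) (tgt L g) = T"
        unfolding T_def \<theta>_def by (intro hat_cong) auto
      then have "hat en \<eta> (\<lambda>p. \<sigma> (p \<bullet> eA L g)) (tgt L (eA L g)) = Eq T (\<theta> g) (\<theta>' g)"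
        using a(6-9) by (simp add: hat.simps[of _ _ _ "tgt L (eA L g)"] \<theta>_def \<theta>'_def)
      then show ?thesis using arrows_okD[OF ar a(3)] by simp
    qed
    \<comment> \<open>Instantiating \<open>v\<close> sets the argument at \<open>g\<close>:
      \<open>\<theta> g\<close> gives back \<open>\<theta>\<close>, and \<open>\<theta>' g\<close>
      yields \<open>\<theta>'\<close> on the arrows out of \<open>A\<close>. So transport leads from
      the type of \<open>arr1 L g\<close> to that of \<open>arr2 L g\<close>.\<close>
    have inst_B: "inst B z = hat en \<eta> (\<theta>(g := z)) A" for z
    proof -
      have "(\<lambda>p. sub (z \<cdot> Var) (((\<lambda>p. wk (\<theta> p))(g := Var 0)) p)) = \<theta>(g := z)"
        by (auto simp: fun_eq_iff)
      then show ?thesis by (simp add: B_def sub_hat del: fun_upd_apply)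
    qed
    have b: "\<Gamma> \<turnstile> HasType (\<sigma> (arr1 L g)) (inst B (\<theta> g))"
      using arrows_okD[OF ar a(1)] a(4) by (simp add: inst_B) (simp add: \<theta>_def A_def)
    have "inst B (\<theta>' g) = hat en \<eta> \<theta>' A"
      unfolding inst_B using \<theta>\<theta>' by (intro hat_cong) auto
    then have "\<Gamma> \<turnstile> HasType (transport B (\<theta> g) (\<theta>' g) (\<sigma> (eA L g)) (\<sigma> (arr1 L g))) (hat en \<eta> \<theta>' A)"
      using transport_type[OF T B B' x y e b] by simp
    then have "\<Gamma> \<turnstile> IsType (Eq (hat en \<eta> \<theta>' A) (\<sigma> (arr2 L g))
        (transport B (\<theta> g) (\<theta>' g) (\<sigma> (eA L g)) (\<sigma> (arr1 L g))))"
      using ty[OF a(2)] arrows_okD[OF ar a(2)] a(5) by (intro eq_form) (auto simp: \<theta>'_def A_def)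
    then show ?thesis
      using X TransOf by (simp add: hat.simps[of _ _ _ X] B_def \<theta>_def \<theta>'_def A_def)
  qed
qed

text \<open>\<open>done\<close> lists the arrows already bound; it holds all dependencies of the
  next one, so \<open>hat_form\<close> applies. \<open>B\<close> must be a type in every context
  because it is reached below all the binders.\<close>

lemma pis_form:
  assumes "linear_extension (ar_less L) (outs L K) (done @ fs)"
    and "\<Gamma> \<turnstile> IsCtx" "arrows_ok \<Gamma> \<eta> \<sigma> (set done)" "sorts_ok \<Gamma> \<eta> (NL L \<inter> tgt L ` outs L K)"
    and "\<And>\<Delta>. \<Delta> \<turnstile> IsCtx \<Longrightarrow> \<Delta> \<turnstile> IsType B"
  shows "\<Gamma> \<turnstile> IsType (pis en \<eta> \<sigma> B fs)"
  using assms(1-4)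
proof (induction fs arbitrary: "done" \<Gamma> \<eta> \<sigma>)
  case (Cons f fs)
  note lin = Cons.prems(1) and next_in = linear_extension_next[OF Cons.prems(1)]
  have f: "f \<in> outs L K" and f_new: "f \<notin> set done" using lin by (auto simp: linear_extension_def)
  have T: "\<Gamma> \<turnstile> IsType (hat en \<eta> (\<lambda>p. \<sigma> (p \<bullet> f)) (tgt L f))" (is "_ \<turnstile> IsType ?T")
    using outs_Ar[OF f] Cons.prems(2) arrows_ok_cmp[OF Cons.prems(3) f next_in]
      sorts_ok_mono[OF Cons.prems(4) below_tgt[OF f]]
    by (intro hat_form) auto
  have "arrows_ok (?T # \<Gamma>) (\<lambda>K. wk (\<eta> K)) ((\<lambda>p. wk (\<sigma> p))(f := Var 0)) (set (done @ [f]))"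
  proof (rule arrows_ok_upd[OF _ T f])
    show "arrows_ok \<Gamma> \<eta> \<sigma> (set (done @ [f]) - {f})"
      using Cons.prems(3) by (auto simp: arrows_ok_def)
    \<comment> \<open>The dependencies of \<open>f\<close> and of the earlier arrows all lie in
      \<open>done\<close>, which omits \<open>f\<close>.\<close>
    show "q \<bullet> p \<noteq> f" if "p \<in> set (done @ [f])" "q \<in> outs L (tgt L p)" for p q
    proof -
      have "q \<bullet> p \<in> set done"
        using that next_in linear_extension_closed[OF lin, of p q] by auto
      then show ?thesis using f_new by auto
    qed
  qed
  then have "?T # \<Gamma> \<turnstile> IsType (pis en (\<lambda>K. wk (\<eta> K)) ((\<lambda>p. wk (\<sigma> p))(f := Var 0)) B fs)"
    using lin ctx_ext[OF T] sorts_ok_wk[OF Cons.prems(4) T] by (intro Cons.IH[of "done @ [f]"]) (auto simp del: fun_upd_apply)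
  then show ?case using T by (simp add: pi_form)
qed (simp add: assms(5))

lemma sort_type_form:
  assumes "K \<in> NL L" "\<Gamma> \<turnstile> IsCtx" "sorts_ok \<Gamma> \<eta> (NL L \<inter> tgt L ` outs L K)"
  shows "\<Gamma> \<turnstile> IsType (sort_type en \<eta> K)"
proof -
  have "\<Gamma> \<turnstile> IsType (arrow Unit (UnivH (hl L K)))"
    using assms(2) by (auto intro!: pi_form unit_form UnivH_form ctx_ext)
  moreover have "\<Gamma> \<turnstile> IsType (pis en \<eta> (\<lambda>_. Star) (UnivH (hl L K)) (en K))"
    using assms en[OF assms(1)] UnivH_form
    by (intro pis_form[of K "[]"]) (auto simp: arrows_ok_def)
  ultimately show ?thesis by (simp add: sort_type_def)
qed

text \<open>The scheme of \<open>pis_form\<close> one level up: a component type depends only on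
  smaller sorts, and these come earlier in the enumeration.\<close>

lemma sigs_form:
  assumes "linear_extension (ob_less L) (NL L) (done @ Ks)"
    and "\<Gamma> \<turnstile> IsCtx" "sorts_ok \<Gamma> \<eta> (set done)"
  shows "\<Gamma> \<turnstile> IsType (sigs en \<eta> Ks)"
  using assms
proof (induction Ks arbitrary: "done" \<Gamma> \<eta>)
  case (Cons K Ks)
  note lin = Cons.prems(1)
  have K: "K \<in> NL L" and K_new: "K \<notin> set done" using lin by (auto simp: linear_extension_def)
  have irrefl: "K \<notin> tgt L ` outs L K"
    using ob_less_tgt ob_order K by (auto simp: NL_def strict_partial_order_on_def)
  have closed: "NL L \<inter> tgt L ` outs L K' \<subseteq> set ys"
    if "linear_extension (ob_less L) (NL L) (ys @ zs)" "K' \<in> set ys" for K' ys zs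
    using linear_extension_prefix[OF that] ob_less_tgt outs_Ar by blast
  have "NL L \<inter> tgt L ` outs L K \<subseteq> set done"
    using closed[of "done @ [K]" Ks K] lin irrefl by auto
  then have T: "\<Gamma> \<turnstile> IsType (sort_type en \<eta> K)"
    using sort_type_form[OF K Cons.prems(2)] sorts_ok_mono[OF Cons.prems(3)] by blast
  let ?\<eta> = "(\<lambda>K'. wk (\<eta> K'))(K := Var 0)"
  have "sorts_ok (sort_type en \<eta> K # \<Gamma>) ?\<eta> (set (done @ [K]))"
    unfolding sorts_ok_def
  proof
    fix K' assume K': "K' \<in> set (done @ [K])"
    \<comment> \<open>Neither \<open>K\<close> nor an earlier sort has an arrow to \<open>K\<close>
      among its non-identity arrows, so overwriting the variable of \<open>K\<close> leaves these
      component types intact.\<close>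
    then have "K \<notin> NL L \<inter> tgt L ` outs L K'"
      using closed[OF lin, of K'] K_new irrefl by auto
    then have "sort_type en ?\<eta> K' = wk (sort_type en \<eta> K')"
      unfolding wk_sort_type using K K' lin
      by (intro sort_type_cong) (auto simp: linear_extension_def)
    then show "sort_type en \<eta> K # \<Gamma> \<turnstile> HasType (?\<eta> K') (sort_type en ?\<eta> K')"
      using K' var_0[OF T] weaken_term[OF sorts_okD[OF Cons.prems(3)] T, of K'] by auto
  qed
  then have "sort_type en \<eta> K # \<Gamma> \<turnstile> IsType (sigs en ?\<eta> Ks)"
    using lin ctx_ext[OF T] by (intro Cons.IH[of "done @ [K]"]) (auto simp del: fun_upd_apply)
  \<comment> \<open>A single remaining sort contributes its type without a trailing
    \<open>Unit\<close>, hence the case split.\<close>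
  then show ?case using T by (cases Ks) (auto intro: sig_form)
qed (simp add: unit_form)

end

theorem theorem4p17:
  fixes L :: "('o, 'a) h_sig"
    and arrows :: "'o \<Rightarrow> 'a list"
    and sorts :: "'o list"
  assumes "h_signature L"
    and "essentially_finite L"
    and "linear_extension (ob_less L) (NL L) sorts"
    and "\<And>K. K \<in> NL L \<Longrightarrow> linear_extension (ar_less L) (outs L K) (arrows K)"
  shows "[] \<turnstile> IsType (h_signature.HStruc L arrows sorts)"
proof -
  interpret enumerated_h_signature L arrows
    using assms(1,4) by (intro enumerated_h_signature.intro enumerated_h_signature_axioms.intro)
  \<comment> \<open>Before any sort is introduced, the dummy environment is vacuously valid.\<close>
  show ?thesis
    unfolding HStruc_def
    using assms(3) by (intro sigs_form[of "[]"]) (auto simp: sorts_ok_def intro: ctx_empty)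
qed

end
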